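(* Let $K>0$, $N\ge3$, $q\in\mathbb{T}=\mathbb{R}/2\pi\mathbb{Z}$, and consider the Kuramoto model $\dot\theta_i=\frac KN\sum_{j=1}^N\sin(\theta_j-\theta_i)$, $i=1,\dots,N$, on $\mathbb{T}^N$. The unstable manifold $W^{\mathrm u}(\theta^N_q)$ of the incoherent equilibrium $$\theta^N_q=\left(\frac{\pi(2i-1-N)}{N}+q\right)_{i=1}^N\in\mathbb{T}^N$$ is two-dimensional and is given explicitly by $$W^{\mathrm u}(\theta^N_q)=\left\{\theta\in\mathbb{T}^N:\ \theta_i=\phi_i(\alpha,\beta,A)\ (1\le i\le N),\ \ \frac1N\sum_{i=1}^N\phi_i(\alpha,\beta,A)= q,\ \ \beta\in[0,1),\ \alpha\in[-\pi,\pi],\ A\in\left[-\tfrac\pi2,\tfrac\pi2\right]\right\},$$ where $\theta_i=\phi_i$ is understood modulo $2\pi$, and in the mean condition the real numbers $\phi_i$ are averaged in $\mathbb{R}$ and the result is compared with $q$ modulo $2\pi$. Moreover, the dynamics on $W^{\mathrm u}(\theta^N_q)$ in these parameters is given by the ODE system $$\dot\beta=\frac K2\beta(1-\beta^2)B_N(A,\beta),\qquad \dot\alpha=\frac K2(1+\beta^2)D_N(A,\beta),\qquad \dot A=\frac K4(1-\beta^2)D_N(A,\beta),$$ that is, if $(\beta,\alpha,A)(t)$ solves this system then $\theta_i(t)=\phi_i(\alpha(t),\beta(t),A(t))$ solves the Kuramoto model.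
   Context: $W^{\mathrm u}(\theta^\star)$ is the global unstable manifold of the equilibrium $\theta^\star$: the set of points whose trajectory converges to $\theta^\star$ as $t\to-\infty$. For $\alpha\in\mathbb{R}$, $\beta\in[0,1)$, $A\in\mathbb{R}$, $\xi\in[0,1]$, $$\phi(\alpha,\beta,A,\xi)=2\arctan\left(\frac{1-\beta}{1+\beta}\tan(\pi\xi+A)\right)-\alpha+2\pi k,$$ where $k\in\mathbb{Z}$ is such that $\pi\xi+A\in[\pi(k-\frac12),\pi(k+\frac12)]$ (extended by continuity when $\pi\xi+A\in\frac\pi2+\pi\mathbb{Z}$, so that $\phi$ is continuous and real-valued). Further $\phi_i(\alpha,\beta,A)=\phi(\alpha,\beta,A,\xi_i)$ with $\xi_i=\frac{2i-1}{2N}$, and $$B_N(A,\beta)=\frac{1+\beta^{2N-2}+\cos(2AN)(-\beta)^{N-2}(1+\beta^2)}{1+\beta^{2N}+2(-\beta)^N\cos(2AN)},\qquad D_N(A,\beta)=\frac{\sin(2AN)(-\beta)^{N-2}(\beta^2-1)}{1+\beta^{2N}+2(-\beta)^N\cos(2AN)}.$$ *)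

theory Defs
  imports "HOL-Analysis.Analysis"
begin

section \<open>The circle \<open>\<real>/2\<pi>\<int>\<close> and the torus\<close>

quotient_type circle = real / "\<lambda>x y. \<exists>k::int. x - y = 2 * pi * of_int k"
  morphisms rep_circle proj
proof (rule equivpI)
  show "reflp (\<lambda>x y. \<exists>k::int. x - y = 2 * pi * of_int k)"
    by (auto intro!: reflpI exI[of _ "0::int"])
  show "symp (\<lambda>x y. \<exists>k::int. x - y = 2 * pi * of_int k)"
  proof (rule sympI)
    fix x y :: real
    assume "\<exists>k::int. x - y = 2 * pi * of_int k"
    then obtain k :: int where "x - y = 2 * pi * of_int k" by blast
    then have "y - x = 2 * pi * of_int (- k)" by simp
    then show "\<exists>k::int. y - x = 2 * pi * of_int k" by blast
  qed
  show "transp (\<lambda>x y. \<exists>k::int. x - y = 2 * pi * of_int k)"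
  proof (rule transpI)
    fix x y z :: real
    assume "\<exists>k::int. x - y = 2 * pi * of_int k" "\<exists>k::int. y - z = 2 * pi * of_int k"
    then obtain k l :: int where "x - y = 2 * pi * of_int k" "y - z = 2 * pi * of_int l" by blast
    then have "x - z = 2 * pi * of_int (k + l)" by (simp add: algebra_simps)
    then show "\<exists>k::int. x - z = 2 * pi * of_int k" by blast
  qed
qed

instantiation circle :: ab_group_add
begin

lift_definition zero_circle :: circle is "0::real" .

lift_definition plus_circle :: "circle \<Rightarrow> circle \<Rightarrow> circle" is "(+)"
proof -
  fix x x' y y' :: real
  assume "\<exists>k::int. x - x' = 2 * pi * of_int k" "\<exists>k::int. y - y' = 2 * pi * of_int k"
  then obtain k l :: int where "x - x' = 2 * pi * of_int k" "y - y' = 2 * pi * of_int l" by blast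
  then have "(x + y) - (x' + y') = 2 * pi * of_int (k + l)" by (simp add: algebra_simps)
  then show "\<exists>k::int. (x + y) - (x' + y') = 2 * pi * of_int k" by blast
qed

lift_definition uminus_circle :: "circle \<Rightarrow> circle" is uminus
proof -
  fix x x' :: real
  assume "\<exists>k::int. x - x' = 2 * pi * of_int k"
  then obtain k :: int where "x - x' = 2 * pi * of_int k" by blast
  then have "- x - - x' = 2 * pi * of_int (- k)" by simp
  then show "\<exists>k::int. - x - - x' = 2 * pi * of_int k" by blast
qed

lift_definition minus_circle :: "circle \<Rightarrow> circle \<Rightarrow> circle" is "(-)"
proof -
  fix x x' y y' :: real
  assume "\<exists>k::int. x - x' = 2 * pi * of_int k" "\<exists>k::int. y - y' = 2 * pi * of_int k"
  then obtain k l :: int where "x - x' = 2 * pi * of_int k" "y - y' = 2 * pi * of_int l" by blast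
  then have "(x - y) - (x' - y') = 2 * pi * of_int (k - l)" by (simp add: algebra_simps)
  then show "\<exists>k::int. (x - y) - (x' - y') = 2 * pi * of_int k" by blast
qed

instance
  by standard (transfer, rule exI[of _ "0::int"], simp)+

end

text \<open>The quotient topology.\<close>

instantiation circle :: topological_space
begin

definition open_circle :: "circle set \<Rightarrow> bool"
  where "open_circle U \<longleftrightarrow> open (proj -` U)"

instance
proof
  show "open (UNIV :: circle set)" by (simp add: open_circle_def)
  show "open (S \<inter> T)" if "open S" "open T" for S T :: "circle set"
    using that by (simp add: open_circle_def vimage_Int open_Int)
  show "open (\<Union>\<U>)" if "\<forall>S\<in>\<U>. open S" for \<U> :: "circle set set"
    using that by (auto simp: open_circle_def vimage_Union intro!: open_UN)
qed

end

lift_definition circle_sin :: "circle \<Rightarrow> real" is sin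
proof -
  fix x x' :: real
  assume "\<exists>k::int. x - x' = 2 * pi * of_int k"
  then obtain k :: int where "x = x' + 2 * pi * of_int k" by (auto simp: algebra_simps)
  then show "sin x = sin x'"
    using sin_int_2pin[of k] cos_int_2pin[of k] by (simp only: sin_add)
qed

text \<open>Points of the torus are functions on \<open>{1..N}\<close>, extended by \<open>undefined\<close>; the type
  \<open>nat \<Rightarrow> circle\<close> carries the product topology.\<close>

definition torus :: "nat \<Rightarrow> (nat \<Rightarrow> circle) set"
  where "torus N = {1..N} \<rightarrow>\<^sub>E UNIV"

text \<open>Derivative of a circle-valued map, read off from a local real-valued lift.\<close>

definition has_circle_derivative ::
    "('a::real_normed_vector \<Rightarrow> circle) \<Rightarrow> ('a \<Rightarrow> real) \<Rightarrow> 'a \<Rightarrow> 'a set \<Rightarrow> bool"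
  where "has_circle_derivative c D u S \<longleftrightarrow>
    (\<exists>x. (\<forall>\<^sub>F v in at u within S. c v = proj (x v)) \<and> c u = proj (x u) \<and>
         (x has_derivative D) (at u within S))"

text \<open>Embedded \<open>C\<^sup>1\<close> submanifold of the torus, of dimension \<open>DIM('e)\<close>: every point has a relatively
  open neighbourhood in \<open>M\<close> which is parametrised homeomorphically by a \<open>C\<^sup>1\<close> immersion of an open
  subset of \<open>'e\<close>.  Since \<open>'e\<close> is finite-dimensional, continuity of the derivative may be
  required for each direction \<open>h\<close> separately.\<close>

definition embedded_C1_submanifold ::
    "'e::euclidean_space itself \<Rightarrow> nat \<Rightarrow> (nat \<Rightarrow> circle) set \<Rightarrow> bool"
  where "embedded_C1_submanifold _ N M \<longleftrightarrow>
    M \<subseteq> torus N \<and>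
    (\<forall>p\<in>M. \<exists>(U::'e set) V f g D.
       open U \<and> openin (top_of_set M) V \<and> p \<in> V \<and> homeomorphism U V f g \<and>
       (\<forall>u\<in>U. \<forall>i\<in>{1..N}. has_circle_derivative (\<lambda>v. f v i) (D i u) u U) \<and>
       (\<forall>i\<in>{1..N}. \<forall>h. continuous_on U (\<lambda>u. D i u h)) \<and>
       (\<forall>u\<in>U. \<forall>h. (\<forall>i\<in>{1..N}. D i u h = 0) \<longrightarrow> h = 0))"

section \<open>The Kuramoto model\<close>

text \<open>\<open>J\<close> is the time domain.\<close>

definition kuramoto_solution ::
    "real \<Rightarrow> nat \<Rightarrow> real set \<Rightarrow> (real \<Rightarrow> nat \<Rightarrow> circle) \<Rightarrow> bool"
  where "kuramoto_solution K N J \<theta> \<longleftrightarrow>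
    (\<forall>t\<in>J. \<theta> t \<in> torus N \<and>
      (\<forall>i\<in>{1..N}. has_circle_derivative (\<lambda>s. \<theta> s i)
         (\<lambda>h. h * (K / real N * (\<Sum>j=1..N. circle_sin (\<theta> t j - \<theta> t i)))) t J))"

text \<open>The Kuramoto vector field is smooth on a compact manifold, so each point has exactly one
  trajectory, defined for all times.\<close>

definition unstable_manifold :: "real \<Rightarrow> nat \<Rightarrow> (nat \<Rightarrow> circle) \<Rightarrow> (nat \<Rightarrow> circle) set"
  where "unstable_manifold K N \<theta>star =
    {\<theta>0 \<in> torus N. \<exists>\<theta>. kuramoto_solution K N UNIV \<theta> \<and> \<theta> 0 = \<theta>0 \<and> (\<theta> \<longlongrightarrow> \<theta>star) at_bot}"

definition incoherent_state :: "nat \<Rightarrow> circle \<Rightarrow> nat \<Rightarrow> circle"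
  where "incoherent_state N q =
    (\<lambda>i\<in>{1..N}. proj (pi * (2 * real i - 1 - real N) / real N) + q)"

section \<open>The parametrisation\<close>

text \<open>With \<open>x = \<pi>\<xi> + A\<close>, the integer \<open>round (x / \<pi>)\<close> is the unique \<open>k\<close> with
  \<open>x \<in> [\<pi>(k - 1/2), \<pi>(k + 1/2)]\<close>, unless \<open>x \<in> \<pi>/2 + \<pi>\<int>\<close>.  In that case both one-sided limits of
  the arctan formula are \<open>2 * x - \<alpha>\<close>; this value is prescribed (HOL's \<open>tan\<close> would be \<open>0\<close> there).\<close>

definition phi :: "real \<Rightarrow> real \<Rightarrow> real \<Rightarrow> real \<Rightarrow> real"
  where "phi \<alpha> \<beta> A \<xi> =
    (let x = pi * \<xi> + A in
     if cos x = 0 then 2 * x - \<alpha>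
     else 2 * arctan ((1 - \<beta>) / (1 + \<beta>) * tan x) - \<alpha> + 2 * pi * of_int (round (x / pi)))"

lemma arctan_scaled_tan:
  fixes y \<beta> :: real
  assumes "\<beta> \<in> {0..<1}" and "-(pi/2) < y" and "y < pi/2"
  shows "arctan ((1 - \<beta>) / (1 + \<beta>) * tan y) = y - arctan (\<beta> * sin (2 * y) / (1 + \<beta> * cos (2 * y)))"
proof -
  define d where "d = 1 + \<beta> * cos (2 * y)"
  define s where "s = \<beta> * sin (2 * y) / d"
  define z where "z = y - arctan s"
  have c: "cos y > 0" using assms by (simp add: cos_gt_zero_pi)
  have "\<bar>\<beta> * cos (2 * y)\<bar> \<le> \<beta> * 1"
    unfolding abs_mult using assms by (intro mult_mono) auto
  then have d: "d > 0" using assms unfolding d_def by auto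
  have sgn_s: "s \<ge> 0" if "y \<ge> 0"
    using that assms d by (auto simp: s_def intro!: divide_nonneg_nonneg mult_nonneg_nonneg sin_ge_zero)
  have sgn_s': "s \<le> 0" if "y \<le> 0"
  proof -
    have "sin (2 * - y) \<ge> 0" using that assms by (intro sin_ge_zero) auto
    then have "\<beta> * sin (2 * y) \<le> 0" using assms by (auto intro: mult_nonneg_nonpos)
    then show ?thesis using d by (simp add: s_def divide_nonpos_pos)
  qed
  have b: "-(pi/2) < arctan s" "arctan s < pi/2" using arctan_bounded by auto
  have z: "-(pi/2) < z \<and> z < pi/2"
  proof (cases "y \<ge> 0")
    case True
    then have "arctan s \<ge> 0" using sgn_s by simp
    then show ?thesis using True b assms unfolding z_def by linarith
  next
    case False
    then have "arctan s \<le> 0" using sgn_s' by simp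
    then show ?thesis using False b assms unfolding z_def by linarith
  qed
  have "cos z > 0" using z by (simp add: cos_gt_zero_pi)
  then have "cos z \<noteq> 0" by simp
  then have "tan z = (tan y - s) / (1 + tan y * s)"
    using c tan_diff[of y "arctan s"] by (simp add: z_def tan_arctan)
  also have "\<dots> = (1 - \<beta>) / (1 + \<beta>) * tan y"
  proof -
    have sc: "(sin y)\<^sup>2 = 1 - (cos y)\<^sup>2" by (simp add: sin_squared_eq)
    have d': "d = 1 - \<beta> + 2 * \<beta> * (cos y)\<^sup>2"
      unfolding d_def cos_double_cos by (simp add: algebra_simps)
    have sd: "s * d = 2 * \<beta> * sin y * cos y" using d by (simp add: s_def sin_double)
    have tc: "tan y * cos y = sin y" using c by (simp add: tan_def)
    have "(tan y - s) * d * cos y = (tan y * cos y) * d - (s * d) * cos y"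
      by (simp add: algebra_simps)
    also have "\<dots> = sin y * (1 - \<beta>)"
      unfolding tc sd unfolding d' by (simp add: algebra_simps power2_eq_square)
    finally have num: "(tan y - s) * d * cos y = sin y * (1 - \<beta>)" .
    have "(1 + tan y * s) * d = d + tan y * (s * d)" by (simp add: algebra_simps)
    also have "\<dots> = d + 2 * \<beta> * sin y * (tan y * cos y)" unfolding sd by (simp add: algebra_simps)
    also have "\<dots> = d + 2 * \<beta> * (sin y)\<^sup>2" unfolding tc by (simp add: power2_eq_square)
    also have "\<dots> = 1 + \<beta>" unfolding d' sc by (simp add: algebra_simps)
    finally have den: "(1 + tan y * s) * d = 1 + \<beta>" .
    have "(1 - \<beta>) / (1 + \<beta>) * tan y = ((tan y - s) * d * cos y) / ((1 + tan y * s) * d * cos y)"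
      unfolding num den by (simp add: tan_def)
    then show ?thesis using c d by simp
  qed
  finally have "arctan ((1 - \<beta>) / (1 + \<beta>) * tan y) = z" using z by (intro arctan_unique) auto
  then show ?thesis by (simp add: z_def s_def d_def)
qed

lemma phi_alt:
  assumes "\<beta> \<in> {0..<1}"
    and x: "pi * \<xi> + A = x"
  shows "phi \<alpha> \<beta> A \<xi> =
    2 * x - \<alpha> - 2 * arctan (\<beta> * sin (2 * x) / (1 + \<beta> * cos (2 * x)))"
proof (cases "cos x = 0")
  case True
  then have "sin (2 * x) = 0" unfolding sin_double by simp
  with True show ?thesis by (simp add: phi_def Let_def x)
next
  case False
  define k where "k = round (x / pi)"
  define y where "y = x - pi * of_int k"
  have xy: "x = y + pi * of_int k" by (simp add: y_def)
  have r: "of_int k \<le> x / pi + 1/2" "x / pi + 1/2 < of_int k + 1"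
    unfolding k_def round_def by linarith+
  have "-(pi/2) \<le> y" "y < pi/2" using r by (auto simp: y_def field_simps)
  moreover have "y \<noteq> -(pi/2)"
  proof
    assume "y = -(pi/2)"
    moreover have "sin (pi * of_int k) = 0" by (auto simp: sin_zero_iff_int2)
    ultimately have "cos x = 0" by (simp add: xy cos_diff)
    then show False using False by simp
  qed
  ultimately have y: "-(pi/2) < y" "y < pi/2" by auto
  have e: "2 * x = 2 * y + 2 * pi * of_int k" by (simp add: xy)
  have "sin (2 * x) = sin (2 * y)" "cos (2 * x) = cos (2 * y)"
    unfolding e sin_add cos_add using sin_int_2pin[of k] cos_int_2pin[of k] by simp_all
  moreover have "tan x = tan y"
    using tan_periodic_int[of y k] by (simp add: xy mult.commute)
  ultimately show ?thesis
    using arctan_scaled_tan[OF assms(1) y] False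
    by (simp add: phi_def Let_def x k_def[symmetric]) (simp add: xy)
qed

text \<open>The prescribed values are indeed those of the continuous extension.\<close>

lemma continuous_on_phi: "continuous_on (UNIV \<times> {0..<1} \<times> UNIV \<times> UNIV) (\<lambda>(\<alpha>, \<beta>, A, \<xi>). phi \<alpha> \<beta> A \<xi>)"
proof -
  have "1 + \<beta> * cos t \<noteq> 0" if "0 \<le> \<beta>" "\<beta> < 1" for \<beta> t :: real
  proof -
    have "\<bar>\<beta> * cos t\<bar> \<le> \<beta> * 1"
      unfolding abs_mult using that by (intro mult_mono) auto
    then show ?thesis using that by linarith
  qed
  then have "continuous_on (UNIV \<times> {0..<1} \<times> UNIV \<times> UNIV)
    (\<lambda>(\<alpha>, \<beta>, A, \<xi>). 2 * (pi * \<xi> + A) - \<alpha> -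
       2 * arctan (\<beta> * sin (2 * (pi * \<xi> + A)) / (1 + \<beta> * cos (2 * (pi * \<xi> + A)))))"
    unfolding case_prod_unfold by (intro continuous_intros) (auto simp: case_prod_unfold)
  then show ?thesis
    by (rule continuous_on_cong[THEN iffD1, rotated 2]) (auto simp: phi_alt[OF _ refl])
qed

definition phi_i :: "nat \<Rightarrow> nat \<Rightarrow> real \<Rightarrow> real \<Rightarrow> real \<Rightarrow> real"
  where "phi_i N i \<alpha> \<beta> A = phi \<alpha> \<beta> A ((2 * real i - 1) / (2 * real N))"

definition phi_point :: "nat \<Rightarrow> real \<Rightarrow> real \<Rightarrow> real \<Rightarrow> nat \<Rightarrow> circle"
  where "phi_point N \<alpha> \<beta> A = (\<lambda>i\<in>{1..N}. proj (phi_i N i \<alpha> \<beta> A))"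

definition B_coeff :: "nat \<Rightarrow> real \<Rightarrow> real \<Rightarrow> real"
  where "B_coeff N A \<beta> =
    (1 + \<beta> ^ (2 * N - 2) + cos (2 * A * real N) * (- \<beta>) ^ (N - 2) * (1 + \<beta>\<^sup>2)) /
    (1 + \<beta> ^ (2 * N) + 2 * (- \<beta>) ^ N * cos (2 * A * real N))"

definition D_coeff :: "nat \<Rightarrow> real \<Rightarrow> real \<Rightarrow> real"
  where "D_coeff N A \<beta> =
    (sin (2 * A * real N) * (- \<beta>) ^ (N - 2) * (\<beta>\<^sup>2 - 1)) /
    (1 + \<beta> ^ (2 * N) + 2 * (- \<beta>) ^ N * cos (2 * A * real N))"

definition reduced_solution ::
    "real \<Rightarrow> nat \<Rightarrow> real set \<Rightarrow> (real \<Rightarrow> real) \<Rightarrow> (real \<Rightarrow> real) \<Rightarrow> (real \<Rightarrow> real) \<Rightarrow> bool"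
  where "reduced_solution K N J \<beta> \<alpha> A \<longleftrightarrow>
    (\<forall>t\<in>J. \<beta> t \<in> {0..<1} \<and>
      (\<beta> has_real_derivative K / 2 * \<beta> t * (1 - (\<beta> t)\<^sup>2) * B_coeff N (A t) (\<beta> t)) (at t within J) \<and>
      (\<alpha> has_real_derivative K / 2 * (1 + (\<beta> t)\<^sup>2) * D_coeff N (A t) (\<beta> t)) (at t within J) \<and>
      (A has_real_derivative K / 4 * (1 - (\<beta> t)\<^sup>2) * D_coeff N (A t) (\<beta> t)) (at t within J))"

end

theory Submission
  imports Defs
begin

text \<open>Put \<open>w\<^sub>j = exp (\<i>\<pi>(2j-1)/N)\<close> and \<open>z = \<beta> exp (-2\<i>A)\<close>.  The point \<open>\<phi>(\<alpha>, \<beta>, A)\<close> has coordinates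
  \<open>exp (\<i>\<phi>\<^sub>j) = exp (\<i>(2A - \<alpha>)) (w\<^sub>j + z) / (1 + cnj z w\<^sub>j)\<close>, a Moebius image of the equidistributed
  configuration, and the mean condition fixes \<open>2A - \<alpha>\<close> in terms of \<open>z\<close>; so the set in the theorem is a
  disc parametrised by \<open>\<bar>z\<bar> < 1\<close>.  On it the flow is \<open>z' = K/2 (1 - \<bar>z\<bar>\<^sup>2) H(z)\<close>, where \<open>H\<close> is the mean of
  the points \<open>(w\<^sub>j + z) / (1 + cnj z w\<^sub>j)\<close>.  This field is Lipschitz on the closed disc, so the flow is
  global, and \<open>Re (cnj z H) > 0\<close> for \<open>z \<noteq> 0\<close> drives every orbit to \<open>0\<close> backwards in time.

  Conversely, along a trajectory the points \<open>v\<^sub>j = exp (\<i>\<theta>\<^sub>j)\<close> obey a common Riccati equation, hence their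
  cross ratios are constant and equal to those of the \<open>w\<^sub>j\<close> if the trajectory comes from the incoherent
  state.  So each \<open>\<theta>(t)\<close> is a Moebius image of the \<open>w\<^sub>j\<close>, and conservation of \<open>\<Prod>v\<^sub>j\<close> gives the mean
  condition.\<close>

section \<open>The circle in the complex plane\<close>

text \<open>The mean is taken in the reals, so it fixes the common rotation, whereas the conserved
  product of the \<open>v i\<close> fixes only its N-th power; continuity in time and the limit at
  minus infinity select the right root. This is why real lifts are carried along:
  \<open>twist\<close> is a principal argument that stays continuous on the whole open disc. Equal
  cross ratios determine a Moebius map of the circle, but such a map may exchange the inside and the
  outside of the disc. The orientation of three points decides between the two cases. It is measured
  by the sign of \<open>norm den - norm num\<close>, which never vanishes along the trajectory and
  is positive in the limit. Each summand of H is singular at the boundary point z = -w_j. The factor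
  1 - |z|^2 vanishes there and leaves a Lipschitz function, which makes the flow global. The bound N
  \<ge> 3 enters twice: three nodes are needed to recover z from the coordinates, and the power of
  -cnj z with exponent N, of modulus at most |z|^3, is too small to cancel |z|^2 in Re (cnj z
  H).\<close>

lift_definition circle_cis :: "circle \<Rightarrow> complex" is cis
proof -
  fix x y :: real
  assume "\<exists>k::int. x - y = 2 * pi * of_int k"
  then obtain k :: int where "x = y + 2 * pi * of_int k" by (auto simp: algebra_simps)
  then show "cis x = cis y" by (simp add: cis_mult[symmetric])
qed

lemma circle_cis_proj [simp]: "circle_cis (proj x) = cis x"
  by (fact circle_cis.abs_eq)

lemma proj_rep [simp]: "proj (rep_circle q) = q"
  by (meson Quotient3_circle Quotient3_abs_rep)

lemma proj_eq_iff: "proj x = proj y \<longleftrightarrow> cis x = cis y"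
proof
  show "proj x = proj y \<Longrightarrow> cis x = cis y" by (metis circle_cis_proj)
next
  assume "cis x = cis y"
  then obtain k :: int where "x = y + 2 * pi * k"
    by (metis complex_eq_iff cis.simps sin_cos_eq_iff)
  then show "proj x = proj y" by (auto simp: circle.abs_eq_iff)
qed

lemma circle_cis_inject: "circle_cis a = circle_cis b \<longleftrightarrow> a = b"
  by (metis circle_cis_proj proj_eq_iff proj_rep)

lemma norm_circle_cis [simp]: "norm (circle_cis a) = 1"
  by transfer simp

lemma proj_add: "proj (x + y) = proj x + proj y"
  by (simp add: plus_circle.abs_eq)

lemma circle_sin_diff: "circle_sin (a - b) = Im (circle_cis a * cnj (circle_cis b))"
  by transfer (simp add: sin_diff)

lemma continuous_on_proj [continuous_intros]:
  "continuous_on S f \<Longrightarrow> continuous_on S (\<lambda>x. proj (f x))"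
proof -
  have "continuous_on UNIV proj"
    by (auto simp: continuous_on_open_vimage open_circle_def)
  then show "continuous_on S f \<Longrightarrow> continuous_on S (\<lambda>x. proj (f x))"
    by (rule continuous_on_compose2) auto
qed

lemma continuous_on_circle_cis: "continuous_on UNIV circle_cis"
proof -
  have "open (circle_cis -` B)" if "open B" for B
  proof -
    have "continuous_on UNIV cis" by (intro continuous_intros)
    then have "open (cis -` B)" using that by (auto simp: continuous_on_open_vimage)
    moreover have "proj -` circle_cis -` B = cis -` B" by auto
    ultimately show ?thesis by (simp add: open_circle_def)
  qed
  then show ?thesis by (simp add: continuous_on_open_vimage)
qed

lemma has_circle_derivative_cis:
  fixes c :: "real \<Rightarrow> circle"
  assumes "has_circle_derivative c (\<lambda>h. h * r) t S"
  shows "((\<lambda>s. circle_cis (c s)) has_vector_derivative of_real r * \<i> * circle_cis (c t)) (at t within S)"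
proof -
  obtain x where x: "\<forall>\<^sub>F v in at t within S. c v = proj (x v)" "c t = proj (x t)"
    "(x has_derivative (\<lambda>h. h * r)) (at t within S)"
    using assms unfolding has_circle_derivative_def by blast
  have "((\<lambda>s. cis (x s)) has_vector_derivative of_real r * \<i> * cis (x t)) (at t within S)"
    unfolding has_vector_derivative_def
    by (rule has_derivative_eq_rhs[OF has_derivative_cis[OF x(3)]]) (auto simp: scaleR_conv_of_real)
  moreover have "\<forall>\<^sub>F v in nhds t. v \<in> S \<longrightarrow> circle_cis (c v) = cis (x v)"
    using x(1) unfolding eventually_at_filter by eventually_elim (use x(2) in force)
  ultimately show ?thesis
    by (subst has_vector_derivative_cong_ev) (auto simp: x(2))
qed

section \<open>Ordinary differential equations on the real line\<close>

text \<open>Gronwall in both time directions: \<open>exp (2 * C * t)\<close> times the squared norm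
  never decreases and \<open>exp (- 2 * C * t)\<close> times it never increases. This keeps points
  of a trajectory apart, keeps orbits inside the disc and makes the cross ratios constant.\<close>

lemma linear_growth_nonvanishing:
  fixes y :: "real \<Rightarrow> 'a::real_inner"
  assumes d: "\<And>t. (y has_vector_derivative y' t) (at t)"
    and b: "\<And>t. norm (y' t) \<le> C * norm (y t)"
    and nz: "y s \<noteq> 0"
  shows "y t \<noteq> 0"
proof -
  have n: "((\<lambda>t. (norm (y t))\<^sup>2) has_real_derivative 2 * (y t \<bullet> y' t)) (at t)" for t
    unfolding power2_norm_eq_inner has_real_derivative_iff_has_vector_derivative
      has_vector_derivative_def
    by (rule has_derivative_eq_rhs,
        rule has_derivative_inner[OF d[unfolded has_vector_derivative_def] d[unfolded has_vector_derivative_def]])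
       (auto simp: inner_commute algebra_simps)
  have c: "\<bar>2 * (y t \<bullet> y' t)\<bar> \<le> 2 * C * (norm (y t))\<^sup>2" for t
  proof -
    have "\<bar>y t \<bullet> y' t\<bar> \<le> norm (y t) * norm (y' t)" by (rule Cauchy_Schwarz_ineq2)
    also have "\<dots> \<le> norm (y t) * (C * norm (y t))" using b by (intro mult_left_mono) auto
    finally show ?thesis by (simp add: power2_eq_square algebra_simps)
  qed
  define e where "e c t = exp (c * t) * (norm (y t))\<^sup>2" for c t
  have ed: "(e c has_real_derivative exp (c * t) * (c * (norm (y t))\<^sup>2 + 2 * (y t \<bullet> y' t))) (at t)" for c t
    unfolding e_def by (rule derivative_eq_intros n refl)+ (simp add: algebra_simps)
  have up: "e (2 * C) r \<le> e (2 * C) t" if "r \<le> t" for r t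
  proof (rule DERIV_nonneg_imp_nondecreasing[OF that])
    fix x
    show "\<exists>l. (e (2 * C) has_real_derivative l) (at x) \<and> 0 \<le> l"
      using ed[of "2*C" x] c[of x] by (intro exI[of _ "exp (2*C * x) * (2*C * (norm (y x))\<^sup>2 + 2 * (y x \<bullet> y' x))"]) auto
  qed
  have down: "e (- 2 * C) t \<le> e (- 2 * C) r" if "r \<le> t" for r t
  proof (rule DERIV_nonpos_imp_nonincreasing[OF that])
    fix x
    show "\<exists>l. (e (- 2 * C) has_real_derivative l) (at x) \<and> l \<le> 0"
      using ed[of "-2*C" x] c[of x] by (intro exI[of _ "exp (-2*C * x) * (-2*C * (norm (y x))\<^sup>2 + 2 * (y x \<bullet> y' x))"])
         (auto simp: mult_le_0_iff)
  qed
  have pos: "e c s > 0" for c using nz by (simp add: e_def)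
  have "\<exists>c. e c t > 0"
    using up[of s t] down[of t s] pos by (metis linear order_less_le_trans)
  then show ?thesis by (auto simp: e_def)
qed

lemma nonvanishing_pos:
  fixes f :: "real \<Rightarrow> real"
  assumes cont: "continuous_on UNIV f" and nz: "\<And>t. f t \<noteq> 0"
    and lim: "(f \<longlongrightarrow> l) at_bot" "l > 0"
  shows "f t > 0"
proof (rule ccontr)
  assume "\<not> f t > 0"
  have "eventually (\<lambda>s. f s > 0) at_bot" using lim by (rule order_tendstoD)
  then obtain s where "f s > 0" by (meson eventually_happens trivial_limit_at_bot_linorder)
  moreover have "connected (range f)" by (rule connected_continuous_image[OF cont]) simp
  ultimately have "0 \<in> range f" using \<open>\<not> f t > 0\<close>
    by (meson connectedD_interval rangeI not_less less_imp_le)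
  then show False using nz by auto
qed

text \<open>Integrating the weight gains the factor 1/\<mu>, the source of the contraction in
  \<open>picard_global\<close>.\<close>

lemma exp_growth_bound_nonneg:
  fixes f :: "real \<Rightarrow> 'a::real_normed_vector"
  assumes d: "\<And>s. (f has_vector_derivative f' s) (at s)"
    and b: "\<And>s. norm (f' s) \<le> C * exp (\<mu> * \<bar>s\<bar>)"
    and "f 0 = 0" "\<mu> > 0" "t \<ge> 0" "C \<ge> 0"
  shows "norm (f t) \<le> C / \<mu> * exp (\<mu> * t)"
proof (cases "t = 0")
  case True
  then show ?thesis using assms by simp
next
  case False
  have "norm (f t - f 0) \<le> C / \<mu> * exp (\<mu> * t) - C / \<mu> * exp (\<mu> * 0)"
  proof (rule differentiable_bound_general[where f' = f' and \<phi>' = "\<lambda>s. C * exp (\<mu> * s)"])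
    show "0 < t" using False \<open>t \<ge> 0\<close> by simp
    show "continuous_on {0..t} f"
      using d by (meson continuous_at_imp_continuous_on has_vector_derivative_continuous)
    show "continuous_on {0..t} (\<lambda>t. C / \<mu> * exp (\<mu> * t))" by (intro continuous_intros)
    show "((\<lambda>t. C / \<mu> * exp (\<mu> * t)) has_vector_derivative C * exp (\<mu> * x)) (at x)" for x
      unfolding has_real_derivative_iff_has_vector_derivative[symmetric]
      using \<open>\<mu> > 0\<close> by (auto intro!: derivative_eq_intros)
    show "norm (f' x) \<le> C * exp (\<mu> * x)" if "0 < x" for x using b[of x] that by simp
  qed (use d in auto)
  moreover have "C / \<mu> \<ge> 0" using assms by simp
  ultimately show ?thesis using \<open>f 0 = 0\<close> by simp
qed

lemma exp_growth_bound:
  fixes f :: "real \<Rightarrow> 'a::real_normed_vector"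
  assumes d: "\<And>s. (f has_vector_derivative f' s) (at s)"
    and b: "\<And>s. norm (f' s) \<le> C * exp (\<mu> * \<bar>s\<bar>)"
    and "f 0 = 0" "\<mu> > 0"
  shows "norm (f t) \<le> C / \<mu> * exp (\<mu> * \<bar>t\<bar>)"
proof -
  have C: "C \<ge> 0" using order_trans[OF norm_ge_zero b[of 0]] by simp
  show ?thesis
  proof (cases "t \<ge> 0")
    case True
    then show ?thesis using exp_growth_bound_nonneg[OF d b, of t] assms C by simp
  next
    case False
    have "norm ((\<lambda>s. f (- s)) (- t)) \<le> C / \<mu> * exp (\<mu> * (- t))"
    proof (rule exp_growth_bound_nonneg[where f' = "\<lambda>s. - f' (- s)"])
      show "((\<lambda>s. f (- s)) has_vector_derivative - f' (- s)) (at s)" for s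
        using vector_diff_chain_at[of uminus "-1" s f "f' (- s)"] d[of "-s"]
          has_vector_derivative_minus[OF has_vector_derivative_id, of "at s"]
        by (simp add: o_def)
      show "norm (- f' (- s)) \<le> C * exp (\<mu> * \<bar>s\<bar>)" for s using b[of "-s"] by simp
    qed (use False assms C in auto)
    then show ?thesis using False by simp
  qed
qed

text \<open>The Picard operator is a contraction for the norm weighted by \<open>exp (- 2 L \<bar>t\<bar>)\<close>, which makes
  the fixed point global in time.\<close>

lemma picard_global:
  fixes V :: "'a::euclidean_space \<Rightarrow> 'a"
  assumes lip: "\<And>x y. dist (V x) (V y) \<le> L * dist x y"
  shows "\<exists>x. x 0 = x0 \<and> (\<forall>t. (x has_vector_derivative V (x t)) (at t))"
proof -
  define L' where "L' = max L 1"
  have L': "L' \<ge> 1" "dist (V x) (V y) \<le> L' * dist x y" for x y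
  proof -
    show "dist (V x) (V y) \<le> L' * dist x y"
      using lip[of x y] mult_right_mono[of L L' "dist x y"] by (auto simp: L'_def)
  qed (simp add: L'_def)
  \<comment> \<open>Integration gains 1/\<mu>, so twice the Lipschitz constant yields the
    contraction factor 1/2; \<open>L'\<close> replaces \<open>L\<close> to make \<mu>
    positive.\<close>
  define \<mu> where "\<mu> = 2 * L'"
  have \<mu>: "\<mu> > 0" using L' by (simp add: \<mu>_def)
  have contV: "continuous_on UNIV V"
  proof -
    have "L'-lipschitz_on UNIV V" using L' by (intro lipschitz_onI) auto
    then show ?thesis by (rule lipschitz_on_continuous_on)
  qed
  \<comment> \<open>The unknown \<open>w\<close> is the curve minus \<open>x0\<close>, damped by the
    weight, so that the weighted norm becomes the sup norm of a complete space.\<close>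
  define X where "X w t = x0 + exp (\<mu> * \<bar>t\<bar>) *\<^sub>R apply_bcontfun w t" for w :: "real \<Rightarrow>\<^sub>C 'a" and t
  have contX: "continuous_on UNIV (X w)" for w
    unfolding X_def by (intro continuous_intros) auto
  have "\<exists>G. G 0 = 0 \<and> (\<forall>t. (G has_vector_derivative V (X w t)) (at t))" for w
  proof -
    have "continuous_on UNIV (\<lambda>t. V (X w t))"
      by (rule continuous_on_compose2[OF contV contX]) auto
    then have "isCont (\<lambda>t. V (X w t)) t" for t by (simp add: continuous_on_eq_continuous_at)
    then obtain F where F: "(F has_vector_derivative V (X w t)) (at t)" for t
      using einterval_antiderivative[of "-\<infinity>" "\<infinity>" "\<lambda>t. V (X w t)"] by auto
    show ?thesis
      using F by (intro exI[of _ "\<lambda>t. F t - F 0"]) (auto intro!: derivative_eq_intros)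
  qed
  then obtain G where G0: "\<And>w. G w 0 = 0"
    and G: "\<And>w t. (G w has_vector_derivative V (X w t)) (at t)" by metis
  have contG: "continuous_on UNIV (G w)" for w
    using G by (meson continuous_at_imp_continuous_on has_vector_derivative_continuous)
  define T where "T w t = exp (- (\<mu> * \<bar>t\<bar>)) *\<^sub>R G w t" for w t
  \<comment> \<open>\<open>V\<close> grows at most linearly, so along \<open>X w\<close> it is
    bounded by a multiple of the weight.\<close>
  have Tb: "T w \<in> bcontfun" for w
  proof -
    obtain M where M: "\<And>t. norm (apply_bcontfun w t) \<le> M"
      using bounded_apply_bcontfun[of w] by (auto simp: bounded_iff)
    define C where "C = norm (V x0) + L' * M"
    have "norm (G w t) \<le> C / \<mu> * exp (\<mu> * \<bar>t\<bar>)" for t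
    proof (rule exp_growth_bound[OF G _ G0 \<mu>])
      fix s
      have "norm (V (X w s)) \<le> norm (V x0) + dist (V (X w s)) (V x0)"
        by (metis dist_norm norm_triangle_sub)
      also have "dist (V (X w s)) (V x0) \<le> L' * (exp (\<mu> * \<bar>s\<bar>) * M)"
        using L'(2)[of "X w s" x0] L'(1) M[of s]
        by (elim order_trans) (auto simp: X_def dist_norm intro!: mult_left_mono)
      also have "norm (V x0) \<le> norm (V x0) * exp (\<mu> * \<bar>s\<bar>)"
        using \<mu> mult_left_mono[of 1 "exp (\<mu> * \<bar>s\<bar>)" "norm (V x0)"] by simp
      finally show "norm (V (X w s)) \<le> C * exp (\<mu> * \<bar>s\<bar>)" by (simp add: C_def algebra_simps)
    qed
    then have "norm (T w t) \<le> C / \<mu>" for t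
      by (simp add: T_def exp_minus field_simps)
    moreover have "continuous_on UNIV (T w)" unfolding T_def by (intro continuous_intros contG)
    ultimately show ?thesis by (intro bcontfun_normI)
  qed
  define P where "P w = Bcontfun (T w)" for w
  have P: "apply_bcontfun (P w) = T w" for w unfolding P_def by (rule Bcontfun_inverse[OF Tb])
  have "\<exists>!w. P w = w"
  proof (rule banach_fix_type[of "1/2"]; (intro allI)?)
    fix w v
    have "norm (G w t - G v t) \<le> (L' * dist w v) / \<mu> * exp (\<mu> * \<bar>t\<bar>)" for t
    proof (rule exp_growth_bound[OF _ _ _ \<mu>, of "\<lambda>t. G w t - G v t" "\<lambda>t. V (X w t) - V (X v t)"])
      fix s
      show "((\<lambda>t. G w t - G v t) has_vector_derivative V (X w s) - V (X v s)) (at s)"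
        by (intro derivative_intros G)
      have "norm (V (X w s) - V (X v s)) \<le> L' * dist (X w s) (X v s)"
        using L'(2) by (simp add: dist_norm)
      also have "dist (X w s) (X v s) = exp (\<mu> * \<bar>s\<bar>) * dist (apply_bcontfun w s) (apply_bcontfun v s)"
        by (simp add: X_def dist_norm flip: scaleR_diff_right)
      also have "\<dots> \<le> exp (\<mu> * \<bar>s\<bar>) * dist w v" by (intro mult_left_mono dist_bounded) auto
      finally show "norm (V (X w s) - V (X v s)) \<le> L' * dist w v * exp (\<mu> * \<bar>s\<bar>)"
        using L'(1) by (simp add: algebra_simps)
    qed (simp add: G0)
    then have "exp (- (\<mu> * \<bar>t\<bar>)) * norm (G w t - G v t)
        \<le> exp (- (\<mu> * \<bar>t\<bar>)) * ((L' * dist w v) / \<mu> * exp (\<mu> * \<bar>t\<bar>))" for t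
      by (intro mult_left_mono) auto
    moreover have "exp (- (\<mu> * \<bar>t\<bar>)) * ((L' * dist w v) / \<mu> * exp (\<mu> * \<bar>t\<bar>)) = 1/2 * dist w v" for t
      using L'(1) by (simp add: exp_minus \<mu>_def)
    moreover have "dist (T w t) (T v t) = exp (- (\<mu> * \<bar>t\<bar>)) * norm (G w t - G v t)" for t
      by (simp add: T_def dist_norm flip: scaleR_diff_right)
    ultimately have "dist (T w t) (T v t) \<le> 1/2 * dist w v" for t by metis
    then show "dist (P w) (P v) \<le> 1/2 * dist w v" by (intro dist_bound) (simp add: P)
  qed auto
  then obtain w where w: "P w = w" by blast
  have "X w t = x0 + G w t" for t
  proof -
    have "apply_bcontfun w t = T w t" using P w by metis
    then show ?thesis by (simp add: X_def T_def flip: exp_add)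
  qed
  then have "X w = (\<lambda>t. x0 + G w t)" by blast
  moreover have "((\<lambda>t. x0 + G w t) has_vector_derivative V (X w t)) (at t)" for t
    using G[of w t] by (auto intro!: derivative_eq_intros)
  ultimately show ?thesis
    using G0 by (intro exI[of _ "X w"]) auto
qed

section \<open>Moebius transformations of the disc\<close>

definition mobius :: "complex \<Rightarrow> complex \<Rightarrow> complex"
  where "mobius z w = (w + z) / (1 + cnj z * w)"

text \<open>For z in the open disc and w on the circle, \<open>1 + cnj z * w\<close> lies in the
  right half plane, so the principal logarithm gives its angle without jumps.\<close>

definition twist :: "complex \<Rightarrow> complex \<Rightarrow> real"
  where "twist z w = Im (Ln (1 + cnj z * w))"

lemma Re_one_plus_pos:
  assumes "norm w < 1"
  shows "Re (1 + w) > 0"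
  using assms abs_Re_le_cmod[of w] by simp

lemma mobius_denom_pos:
  assumes "norm z < 1" "norm w = 1"
  shows "Re (1 + cnj z * w) > 0"
  by (rule Re_one_plus_pos) (use assms in \<open>simp add: norm_mult\<close>)

lemma mobius_denom_nonzero:
  assumes "norm z < 1" "norm w = 1"
  shows "1 + cnj z * w \<noteq> 0"
  using mobius_denom_pos[OF assms] by (metis less_irrefl zero_complex.simps(1))

lemma cnj_unimodular:
  assumes "norm w = 1"
  shows "w * cnj w = 1" "cnj w * w = 1"
  using assms complex_norm_square[of w] by (simp_all add: mult.commute)

text \<open>On the circle \<open>w + z = w * cnj g\<close> with \<open>g = 1 + cnj z * w\<close>,
  and \<open>cnj g / g\<close> is unimodular with angle minus twice that of
  \<open>g\<close>.\<close>

lemma mobius_eq_twist: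
  assumes "norm z < 1" "norm w = 1"
  shows "mobius z w = w * cis (- 2 * twist z w)"
proof -
  define g where "g = 1 + cnj z * w"
  have g: "g \<noteq> 0" using mobius_denom_nonzero[OF assms] by (simp add: g_def)
  have polar: "g = of_real (norm g) * cis (Arg g)"
    using rcis_cmod_Arg[of g] by (simp add: rcis_def)
  then have "cnj g = of_real (norm g) * cis (- Arg g)"
    by (metis complex_cnj_mult complex_cnj_complex_of_real cis_cnj)
  then have "cnj g / g = (of_real (norm g) * cis (- Arg g)) / (of_real (norm g) * cis (Arg g))"
    using polar by simp
  also have "\<dots> = cis (- Arg g) / cis (Arg g)" using g by simp
  also have "\<dots> = cis (- 2 * Arg g)" by (simp add: cis_divide)
  finally have "cnj g / g = cis (- 2 * twist z w)" using g by (simp add: twist_def g_def Arg_eq_Im_Ln)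
  moreover have "w + z = w * cnj g"
    using cnj_unimodular[OF assms(2)] by (simp add: g_def algebra_simps)
  ultimately show ?thesis by (metis mobius_def g_def times_divide_eq_right)
qed

lemma norm_mobius [simp]:
  assumes "norm z < 1" "norm w = 1"
  shows "norm (mobius z w) = 1"
  using assms by (simp add: mobius_eq_twist norm_mult)

lemma mobius_0 [simp]: "mobius 0 w = w"
  by (simp add: mobius_def)

lemma mobius_inject:
  assumes "norm z < 1" "norm w = 1" "norm w' = 1"
  shows "mobius z w = mobius z w' \<longleftrightarrow> w = w'"
proof
  assume "mobius z w = mobius z w'"
  then have "(w + z) * (1 + cnj z * w') = (w' + z) * (1 + cnj z * w)"
    using mobius_denom_nonzero assms by (simp add: mobius_def frac_eq_eq)
  then have "(w - w') * (1 - z * cnj z) = 0" by (simp add: algebra_simps)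
  moreover have "1 - z * cnj z \<noteq> 0"
  proof -
    have "(norm z)\<^sup>2 \<noteq> 1" using assms(1) by (simp add: power2_eq_1_iff) (smt (verit) norm_ge_zero)
    then show ?thesis by (metis complex_norm_square eq_iff_diff_eq_0 of_real_eq_1_iff)
  qed
  ultimately show "w = w'" by simp
qed simp

lemma mobius_diff:
  assumes "1 + cnj z * x \<noteq> 0" "1 + cnj z * y \<noteq> 0"
  shows "mobius z x - mobius z y =
    (1 - z * cnj z) * (x - y) / ((1 + cnj z * x) * (1 + cnj z * y))"
proof -
  have "mobius z x - mobius z y =
    ((x + z) * (1 + cnj z * y) - (y + z) * (1 + cnj z * x)) / ((1 + cnj z * x) * (1 + cnj z * y))"
    unfolding mobius_def using assms by (simp add: diff_frac_eq)
  also have "(x + z) * (1 + cnj z * y) - (y + z) * (1 + cnj z * x) = (1 - z * cnj z) * (x - y)"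
    by (simp add: algebra_simps)
  finally show ?thesis .
qed

text \<open>By \<open>mobius_diff\<close> both sides carry the same denominators, each point
  contributing once. The form without division also covers coinciding points.\<close>

lemma mobius_cross_ratio:
  assumes "norm z < 1" "norm x1 = 1" "norm x2 = 1" "norm x3 = 1" "norm x4 = 1"
  shows "(mobius z x1 - mobius z x2) * (mobius z x3 - mobius z x4) * ((x1 - x3) * (x2 - x4)) =
    (x1 - x2) * (x3 - x4) * ((mobius z x1 - mobius z x3) * (mobius z x2 - mobius z x4))"
proof -
  have d: "mobius z x - mobius z y = (1 - z * cnj z) * (x - y) / ((1 + cnj z * x) * (1 + cnj z * y))"
    if "norm x = 1" "norm y = 1" for x y
    using that by (intro mobius_diff mobius_denom_nonzero assms(1))
  show ?thesis by (simp only: d assms) (simp add: mult_ac)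
qed

text \<open>Both equations are affine in the fourth point. Two different solutions would make the
  coefficient of that point vanish, and what remains then contradicts the distinctness of the
  \<open>v\<close>.\<close>

lemma cross_ratio_unique:
  fixes v1 v2 v3 x y c d :: "'a::idom"
  assumes "(v1 - v2) * (v3 - x) * c = d * ((v1 - v3) * (v2 - x))"
    and "(v1 - v2) * (v3 - y) * c = d * ((v1 - v3) * (v2 - y))"
    and "v1 \<noteq> v2" "v2 \<noteq> v3" "c \<noteq> 0"
  shows "x = y"
proof (rule ccontr)
  assume "x \<noteq> y"
  have "(x - y) * ((v1 - v2) * c - d * (v1 - v3)) = 0" using assms(1,2) by algebra
  with \<open>x \<noteq> y\<close> have "(v1 - v2) * c = d * (v1 - v3)" by simp
  with assms(1) have "(v1 - v2) * c * (v3 - v2) = 0" by algebra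
  then show False using assms by simp
qed

text \<open>The relations \<open>p * w + r = v * (1 + cnj z * w)\<close> at three points \<open>(w, v)\<close> form a linear system;
  Cramer's rule gives \<open>cnj z = mobius_num / mobius_den\<close>.\<close>

definition mobius_num :: "complex \<Rightarrow> complex \<Rightarrow> complex \<Rightarrow> complex \<Rightarrow> complex \<Rightarrow> complex \<Rightarrow> complex"
  where "mobius_num w1 w2 w3 v1 v2 v3 = v1 * (w2 - w3) + v2 * (w3 - w1) + v3 * (w1 - w2)"

definition mobius_den :: "complex \<Rightarrow> complex \<Rightarrow> complex \<Rightarrow> complex \<Rightarrow> complex \<Rightarrow> complex \<Rightarrow> complex"
  where "mobius_den w1 w2 w3 v1 v2 v3 =
    v1 * w1 * (w3 - w2) + v2 * w2 * (w1 - w3) + v3 * w3 * (w2 - w1)"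

text \<open>Since \<open>cnj a = 1 / a\<close> on the circle, the difference of the squared norms
  is, up to a nonzero factor, the product of all differences of the \<open>v\<close> and of the
  \<open>w\<close>. Its sign tells whether the two triples have the same orientation.\<close>

lemma norm_mobius_den_neq:
  assumes v: "norm v1 = 1" "norm v2 = 1" "norm v3 = 1" "v1 \<noteq> v2" "v2 \<noteq> v3" "v3 \<noteq> v1"
    and w: "norm w1 = 1" "norm w2 = 1" "norm w3 = 1" "w1 \<noteq> w2" "w2 \<noteq> w3" "w3 \<noteq> w1"
  shows "norm (mobius_den w1 w2 w3 v1 v2 v3) \<noteq> norm (mobius_num w1 w2 w3 v1 v2 v3)"
proof
  let ?d = "mobius_den w1 w2 w3 v1 v2 v3" and ?n = "mobius_num w1 w2 w3 v1 v2 v3"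
  assume "norm ?d = norm ?n"
  then have eq: "?d * cnj ?d = ?n * cnj ?n" by (metis complex_norm_square)
  have nz: "v1 \<noteq> 0" "v2 \<noteq> 0" "v3 \<noteq> 0" "w1 \<noteq> 0" "w2 \<noteq> 0" "w3 \<noteq> 0" using v w by auto
  have cnj: "cnj a = 1 / a" if "norm a = 1" for a
    using that cnj_unimodular[OF that] by (metis div_by_1 nonzero_eq_divide_eq norm_zero zero_neq_one)
  have cd: "cnj ?d * (v1 * v2 * v3 * w1 * w2 * w3) =
      v2 * v3 * (w2 - w3) + v3 * v1 * (w3 - w1) + v1 * v2 * (w1 - w2)"
    unfolding mobius_den_def using nz
    by (simp add: cnj v w) (simp add: field_simps)
  have cn: "cnj ?n * (v1 * v2 * v3 * w1 * w2 * w3) =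
      v2 * v3 * w1 * (w3 - w2) + v3 * v1 * w2 * (w1 - w3) + v1 * v2 * w3 * (w2 - w1)"
    unfolding mobius_num_def using nz
    by (simp add: cnj v w) (simp add: field_simps)
  have "?d * (v2 * v3 * (w2 - w3) + v3 * v1 * (w3 - w1) + v1 * v2 * (w1 - w2)) =
      ?n * (v2 * v3 * w1 * (w3 - w2) + v3 * v1 * w2 * (w1 - w3) + v1 * v2 * w3 * (w2 - w1))"
    unfolding cd[symmetric] cn[symmetric] using eq by (simp add: mult.assoc[symmetric])
  then have "(v1 - v2) * (v2 - v3) * (v3 - v1) * ((w1 - w2) * (w2 - w3) * (w3 - w1)) = 0"
    unfolding mobius_den_def mobius_num_def by algebra
  then show False using v w by simp
qed

text \<open>The three linear relations eliminate \<open>p\<close>, so \<open>z\<close> can be read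
  off from three image points whatever the rotation is. This serves as a continuous inverse of the
  parametrisation.\<close>

lemma mobius_recover:
  assumes z: "norm z < 1" and p: "norm p = 1"
    and w: "norm w1 = 1" "norm w2 = 1" "norm w3 = 1" "w1 \<noteq> w2" "w2 \<noteq> w3" "w3 \<noteq> w1"
  defines "v \<equiv> \<lambda>w. p * mobius z w"
  shows "mobius_den w1 w2 w3 (v w1) (v w2) (v w3) \<noteq> 0"
    and "cnj (mobius_num w1 w2 w3 (v w1) (v w2) (v w3) / mobius_den w1 w2 w3 (v w1) (v w2) (v w3)) = z"
proof -
  let ?d = "mobius_den w1 w2 w3 (v w1) (v w2) (v w3)" and ?n = "mobius_num w1 w2 w3 (v w1) (v w2) (v w3)"
  have l: "p * x + p * z = v x * (1 + cnj z * x)" if "norm x = 1" for x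
  proof -
    have "mobius z x * (1 + cnj z * x) = x + z"
      using mobius_denom_nonzero[OF z that] by (simp add: mobius_def)
    then show ?thesis unfolding v_def by (metis distrib_left mult.assoc)
  qed
  have eq: "?n = cnj z * ?d"
    unfolding mobius_num_def mobius_den_def using l[OF w(1)] l[OF w(2)] l[OF w(3)] by algebra
  have "p \<noteq> 0" using p by auto
  have n: "norm (v x) = 1" if "norm x = 1" for x using that z p by (simp add: v_def norm_mult)
  have i: "v x \<noteq> v y" if "x \<noteq> y" "norm x = 1" "norm y = 1" for x y
    using that mobius_inject[OF z that(2,3)] \<open>p \<noteq> 0\<close> by (simp add: v_def)
  \<comment> \<open>If \<open>?d\<close> were 0, then \<open>?n = cnj z * ?d\<close> would be 0 too
    and the norms would agree.\<close>
  have "norm ?d \<noteq> norm ?n"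
    by (rule norm_mobius_den_neq) (use w n i in auto)
  then show "?d \<noteq> 0" using eq by auto
  then show "cnj (?n / ?d) = z" unfolding eq by simp
qed

lemma quadratic_three_roots:
  fixes a b c :: "'a::idom"
  assumes "\<And>x. x \<in> {x1, x2, x3} \<Longrightarrow> a * x\<^sup>2 + b * x + c = 0"
    and "x1 \<noteq> x2" "x2 \<noteq> x3" "x3 \<noteq> x1"
  shows "a = 0" "b = 0" "c = 0"
proof -
  have e: "a * x1^2 + b * x1 + c = 0" "a * x2^2 + b * x2 + c = 0" "a * x3^2 + b * x3 + c = 0"
    using assms(1) by auto
  have "(x1 - x2) * (a * (x1 + x2) + b) = 0" "(x1 - x3) * (a * (x1 + x3) + b) = 0"
    using e by algebra+
  then have f: "a * (x1 + x2) + b = 0" "a * (x1 + x3) + b = 0" using assms by auto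
  then have "a * (x2 - x3) = 0" by algebra
  then show "a = 0" using assms by auto
  then show "b = 0" using f by auto
  with \<open>a = 0\<close> show "c = 0" using e by auto
qed

text \<open>Cramer's rule gives a map \<open>(p * x + r) / (1 + cnj z * x)\<close> through the three
  pairs. That it takes three points of the circle to the circle is a quadratic condition with three
  roots, and its vanishing coefficients force \<open>norm p = 1\<close> and
  \<open>r = p * z\<close>.\<close>

lemma mobius_exists:
  assumes v: "norm v1 = 1" "norm v2 = 1" "norm v3 = 1" "v1 \<noteq> v2" "v2 \<noteq> v3" "v3 \<noteq> v1"
    and w: "norm w1 = 1" "norm w2 = 1" "norm w3 = 1" "w1 \<noteq> w2" "w2 \<noteq> w3" "w3 \<noteq> w1"
    and lt: "norm (mobius_num w1 w2 w3 v1 v2 v3) < norm (mobius_den w1 w2 w3 v1 v2 v3)"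
  defines "z \<equiv> cnj (mobius_num w1 w2 w3 v1 v2 v3 / mobius_den w1 w2 w3 v1 v2 v3)"
  shows "norm z < 1"
    and "\<exists>p. norm p = 1 \<and> v1 = p * mobius z w1 \<and> v2 = p * mobius z w2 \<and> v3 = p * mobius z w3"
proof -
  have d: "mobius_den w1 w2 w3 v1 v2 v3 \<noteq> 0" using lt by auto
  then show z: "norm z < 1" using lt by (simp add: z_def norm_divide)
  have nz: "mobius_num w1 w2 w3 v1 v2 v3 = cnj z * mobius_den w1 w2 w3 v1 v2 v3"
    using d by (simp add: z_def)
  define p where "p = (v1 - v2 + cnj z * (v1 * w1 - v2 * w2)) / (w1 - w2)"
  define r where "r = v1 * (1 + cnj z * w1) - p * w1"
  have p: "p * (w1 - w2) = v1 - v2 + cnj z * (v1 * w1 - v2 * w2)" using w by (simp add: p_def)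
  have e1: "p * w1 + r = v1 * (1 + cnj z * w1)" by (simp add: r_def)
  have e2: "p * w2 + r = v2 * (1 + cnj z * w2)" using p e1 by algebra
  have "(w1 - w2) * (p * w3 + r - v3 * (1 + cnj z * w3)) = 0"
    using p e1 nz unfolding mobius_num_def mobius_den_def by algebra
  then have e3: "p * w3 + r = v3 * (1 + cnj z * w3)" using w by simp
  have key: "(p * x + r) * (cnj p + cnj r * x) = (x + z) * (1 + cnj z * x)"
    if x: "norm x = 1" and y: "norm y = 1" and e: "p * x + r = y * (1 + cnj z * x)" for x y
  proof -
    have "cnj p * cnj x + cnj r = cnj y * (1 + z * cnj x)"
      using arg_cong[OF e, of cnj] by simp
    then have "y * (cnj p + cnj r * x) = x + z"
      using cnj_unimodular[OF x] cnj_unimodular[OF y] by algebra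
    then show ?thesis unfolding e by algebra
  qed
  have *: "(p * cnj r - cnj z) * x\<^sup>2 + (p * cnj p + r * cnj r - 1 - z * cnj z) * x + (r * cnj p - z) = 0"
    if "x \<in> {w1, w2, w3}" for x
    using that key[OF w(1) v(1) e1] key[OF w(2) v(2) e2] key[OF w(3) v(3) e3]
    by (auto simp: algebra_simps power2_eq_square)
  note q = quadratic_three_roots[OF * w(4-6)]
  have rp: "r * cnj p = z" using q(3) by simp
  \<comment> \<open>The coefficients say that |p|^2 and |r|^2 have the same sum and product as 1 and
    |z|^2.\<close>
  have "(p * cnj p - 1) * (p * cnj p - z * cnj z) = 0"
    using q(1,2) rp by algebra
  \<comment> \<open>In the other case the map degenerates to the constant \<open>r\<close>, against
    \<open>v1 \<noteq> v2\<close>.\<close>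
  moreover have "p * cnj p \<noteq> z * cnj z"
  proof
    assume a: "p * cnj p = z * cnj z"
    then have rr: "r * cnj r = 1" using q(2) by simp
    then have "p = cnj z * r" using q(1) by algebra
    then have "v1 = r \<and> v2 = r"
      using e1 e2 mobius_denom_nonzero[OF z w(1)] mobius_denom_nonzero[OF z w(2)]
      by (metis add.commute distrib_left mult.assoc mult.commute mult_cancel_right mult.right_neutral)
    then show False using v by simp
  qed
  ultimately have pp: "p * cnj p = 1" by simp
  then have "complex_of_real ((norm p)\<^sup>2) = 1" by (simp only: complex_norm_square)
  then have "(norm p)\<^sup>2 = 1" by (simp only: of_real_eq_1_iff)
  then have "norm p = 1" using norm_ge_zero[of p] by (auto simp: power2_eq_1_iff)
  have "r = p * z" using rp pp by (metis mult.assoc mult.commute mult.right_neutral)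
  have "y = p * mobius z x" if "p * x + r = y * (1 + cnj z * x)" "norm x = 1" for x y
    using that mobius_denom_nonzero[OF z that(2)] \<open>r = p * z\<close>
    by (simp add: mobius_def field_simps)
  then show "\<exists>p. norm p = 1 \<and> v1 = p * mobius z w1 \<and> v2 = p * mobius z w2 \<and> v3 = p * mobius z w3"
    using e1 e2 e3 w \<open>norm p = 1\<close> by blast
qed

section \<open>The equidistributed configuration and its order parameter\<close>

definition node :: "nat \<Rightarrow> nat \<Rightarrow> complex"
  where "node N j = cis (pi * (2 * real j - 1) / real N)"

lemma norm_node [simp]: "norm (node N j) = 1"
  by (simp add: node_def)

lemma node_power:
  assumes "N > 0"
  shows "node N j ^ N = -1"
proof -
  have "real N * (x / real N) = x" for x using assms by simp
  then have "real N * (pi * (2 * real j - 1) / real N) = 2 * pi * real j - pi"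
    by (simp only:) (simp add: right_diff_distrib)
  then have "node N j ^ N = cis (2 * pi * real j) / cis pi"
    by (simp only: node_def Complex.DeMoivre cis_divide)
  then show ?thesis by (simp add: cis_multiple_2pi)
qed

lemma node_inject:
  assumes "i \<in> {1..N}" "j \<in> {1..N}"
  shows "node N i = node N j \<longleftrightarrow> i = j"
proof -
  have sin2: "cis a \<noteq> cis b" if "0 < a - b" "a - b < 2 * pi" for a b :: real
  proof
    assume "cis a = cis b"
    then obtain k :: int where k: "a = b + 2 * pi * k"
      by (metis complex_eq_iff cis.simps sin_cos_eq_iff)
    then have "0 < 2 * pi * k" "2 * pi * k < 2 * pi * 1" using that by auto
    then have "0 < k" "k < 1" by (auto simp: zero_less_mult_iff mult_less_cancel_left)
    then show False by simp
  qed
  have *: "node N i \<noteq> node N j" if "j < i" "i < N + j" for i j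
  proof -
    define d where "d = (real i - real j) / real N"
    have "real i < real N + real j" using that(2) by (simp flip: of_nat_add)
    then have d: "0 < d" "d < 1" using that assms by (auto simp: d_def)
    have "pi * (2 * real i - 1) / real N - pi * (2 * real j - 1) / real N = 2 * pi * d"
      unfolding d_def diff_divide_distrib[symmetric] by (simp add: algebra_simps)
    then show ?thesis unfolding node_def using d by (intro sin2) auto
  qed
  show ?thesis using *[of i j] *[of j i] assms by (cases i j rule: linorder_cases) auto
qed

lemma node_distinct:
  assumes "N \<ge> 3"
  shows "node N 1 \<noteq> node N 2" "node N 2 \<noteq> node N 3" "node N 3 \<noteq> node N 1"
  using assms by (simp_all add: node_inject)

lemma sum_node_power:
  assumes "N > 0" "k \<le> N"
  shows "(\<Sum>j=1..N. node N j ^ k) = (if k = 0 then of_nat N else if k = N then - of_nat N else 0)"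
proof -
  consider "k = 0" | "k = N" "k \<noteq> 0" | "0 < k" "k < N" using assms by linarith
  then show ?thesis
  proof cases
    case 3
    define \<zeta> where "\<zeta> = cis (2 * pi * real k / real N)"
    have z1: "\<zeta> \<noteq> 1"
    proof
      assume "\<zeta> = 1"
      then have "cos (2 * pi * real k / real N) = 1" by (simp add: \<zeta>_def complex_eq_iff)
      then obtain m :: int where m: "2 * pi * real k / real N = m * 2 * pi"
        by (auto simp: cos_one_2pi_int)
      then have "real k = m * real N" using assms by (simp add: field_simps)
      then have "int k = m * int N" by (metis of_int_mult of_int_of_nat_eq of_int_eq_iff)
      from this[symmetric] have "0 < m * int N" "m * int N < 1 * int N" using 3 by simp_all
      then have "0 < m" by (simp add: zero_less_mult_iff)
      moreover have "m < 1"
        using \<open>m * int N < 1 * int N\<close> mult_right_mono[of 1 m "int N"] by linarith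
      ultimately show False by simp
    qed
    have zN: "\<zeta> ^ N = 1"
      using assms unfolding \<zeta>_def Complex.DeMoivre by (simp add: cis_multiple_2pi)
    have "node N (Suc j) ^ k = cis (pi * real k / real N) * \<zeta> ^ j" for j
      unfolding node_def \<zeta>_def Complex.DeMoivre cis_mult
      by (rule arg_cong[of _ _ cis]) (use assms in \<open>simp add: field_simps\<close>)
    then have "(\<Sum>j=1..N. node N j ^ k) = (\<Sum>j<N. cis (pi * real k / real N) * \<zeta> ^ j)"
      by (simp add: sum.atLeast1_atMost_eq)
    also have "\<dots> = 0"
      using geometric_sum[OF z1, of N] zN by (simp flip: sum_distrib_left)
    finally show ?thesis using 3 by simp
  qed (use assms in \<open>simp_all add: node_power\<close>)
qed

definition order_param :: "nat \<Rightarrow> complex \<Rightarrow> complex"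
  where "order_param N z = (\<Sum>j=1..N. mobius z (node N j)) / of_nat N"

text \<open>Because the nodes are roots of w^N = -1, multiplying by \<open>1 + (- cnj z) ^ N\<close>
  turns the geometric series of each summand into a polynomial in the node. Of its power sums only
  those with exponents 0 and N survive.\<close>

lemma order_param_closed_form:
  assumes "N > 0" "norm z < 1"
  shows "(1 + (- cnj z) ^ N) * order_param N z = z - (- cnj z) ^ (N - 1)"
proof -
  define s where "s = - cnj z"
  have m: "(1 + s ^ N) * mobius z w = (\<Sum>k<N. s ^ k * w ^ Suc k + z * (s ^ k * w ^ k))"
    if w: "w = node N j" for w j
  proof -
    have "1 + s ^ N = 1 - (s * w) ^ N" using node_power[OF assms(1), of j] by (simp add: w power_mult_distrib)
    also have "\<dots> = (1 - s * w) * (\<Sum>k<N. (s * w) ^ k)" by (rule one_diff_power_eq)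
    finally have "(1 + s ^ N) * mobius z w = (w + z) * (\<Sum>k<N. (s * w) ^ k)"
      using mobius_denom_nonzero[OF assms(2), of w] by (simp add: mobius_def s_def w)
    then show ?thesis
      by (simp add: sum_distrib_left distrib_right sum.distrib power_mult_distrib algebra_simps)
  qed
  have "(1 + s ^ N) * (\<Sum>j=1..N. mobius z (node N j))
      = (\<Sum>k<N. s ^ k * (\<Sum>j=1..N. node N j ^ Suc k) + z * (s ^ k * (\<Sum>j=1..N. node N j ^ k)))"
    unfolding sum_distrib_left m[OF refl] by (subst sum.swap) (simp add: sum.distrib)
  also have "\<dots> = (\<Sum>k<N. (if k = N - 1 then - of_nat N * s ^ k else 0) + (if k = 0 then z * of_nat N else 0))"
  proof (intro sum.cong refl)
    fix k
    assume "k \<in> {..<N}"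
    then have k: "k < N" by simp
    have S: "(\<Sum>j=1..N. node N j ^ Suc k) = (if k = N - 1 then - of_nat N else 0)"
      using k sum_node_power[OF assms(1), of "Suc k"] by (auto simp del: power_Suc)
    have S0: "(\<Sum>j=1..N. node N j ^ k) = (if k = 0 then of_nat N else 0)"
      using k sum_node_power[OF assms(1), of k] by auto
    show "s ^ k * (\<Sum>j=1..N. node N j ^ Suc k) + z * (s ^ k * (\<Sum>j=1..N. node N j ^ k)) =
        (if k = N - 1 then - of_nat N * s ^ k else 0) + (if k = 0 then z * of_nat N else 0)"
      unfolding S S0 by auto
  qed
  also have "\<dots> = of_nat N * (z - s ^ (N - 1))"
    using assms(1) by (simp add: sum.distrib sum.delta algebra_simps)
  finally show ?thesis
    using assms(1) by (simp add: order_param_def s_def[symmetric])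
qed

lemma norm_order_param_le:
  assumes "norm z < 1"
  shows "norm (order_param N z) \<le> 1"
proof -
  have "norm (\<Sum>j=1..N. mobius z (node N j)) \<le> (\<Sum>j=1..N. 1)"
    using assms by (intro sum_norm_le) simp
  then show ?thesis by (cases "N = 0") (simp_all add: order_param_def norm_divide)
qed

text \<open>The sum on the right is the one in the derivative of \<open>disc_phase\<close>; this
  expresses that derivative through the order parameter.\<close>

lemma order_param_expansion:
  assumes "N > 0" "norm z < 1"
  shows "order_param N z =
    z + (1 - (norm z)\<^sup>2) * (\<Sum>j=1..N. node N j / (1 + cnj z * node N j)) / of_nat N"
proof -
  have "mobius z w = z + (1 - (norm z)\<^sup>2) * (w / (1 + cnj z * w))" if "norm w = 1" for w
  proof -
    have "w + z = z * (1 + cnj z * w) + (1 - (norm z)\<^sup>2) * w"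
      unfolding of_real_diff complex_norm_square by (simp add: algebra_simps)
    then show ?thesis
      using mobius_denom_nonzero[OF assms(2) that] by (simp add: mobius_def add_divide_distrib)
  qed
  then have "(\<Sum>j=1..N. mobius z (node N j)) =
      of_nat N * z + (1 - (norm z)\<^sup>2) * (\<Sum>j=1..N. node N j / (1 + cnj z * node N j))"
    by (simp add: sum.distrib sum_distrib_left)
  then show ?thesis using assms(1) by (simp add: order_param_def add_divide_distrib)
qed

text \<open>With r = |z|, y the power of -cnj z with exponent N and \<rho> = |y|, the closed form
  gives cnj z H = (r^2 + y) / (1 + y). The real part has a numerator of at least (r^2 - \<rho>)(1 -
  \<rho>) and a denominator of at most 4. Here N \<ge> 3 gives \<rho> \<le> r^3; for N = 2 the
  number r^2 + y vanishes at imaginary z.\<close>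

lemma Re_order_param_ge:
  assumes "N \<ge> 3" "norm z < 1"
  shows "Re (cnj z * order_param N z) \<ge> (norm z)\<^sup>2 * (1 - norm z)\<^sup>2 / 4"
proof -
  define y where "y = (- cnj z) ^ N"
  define r where "r = norm z"
  define \<rho> where "\<rho> = norm y"
  have r: "0 \<le> r" "r < 1" using assms by (auto simp: r_def)
  have "\<rho> = r ^ N" by (simp add: \<rho>_def y_def r_def norm_power)
  then have \<rho>: "\<rho> \<le> r ^ 3" "0 \<le> \<rho>" using r assms by (auto intro: power_decreasing simp: \<rho>_def)
  have r3: "r ^ 3 = r\<^sup>2 * r" by (simp add: eval_nat_numeral)
  have r3le: "r ^ 3 \<le> r" using power_decreasing[of 1 3 r] r by simp
  have "\<rho> < 1" using \<rho> r3le r by linarith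
  then have y1: "1 + y \<noteq> 0" using Re_one_plus_pos[of y] by (metis \<rho>_def less_irrefl zero_complex.simps(1))
  have "cnj z * (- cnj z) ^ (N - 1) = - ((- cnj z) ^ N)"
    using assms(1) by (cases N) auto
  moreover have *: "(1 + u) * (c * h) = x * c + u"
    if "c * v = - u" "(1 + u) * h = x - v" for u c h v x :: complex
    using that by algebra
  ultimately have "(1 + y) * (cnj z * order_param N z) = r\<^sup>2 + y"
    using order_param_closed_form[OF _ assms(2), of N] assms(1)
    unfolding y_def r_def complex_norm_square by (intro *) auto
  then have "cnj z * order_param N z = (r\<^sup>2 + y) / (1 + y)" using y1 by (simp add: field_simps)
  also have "\<dots> = (r\<^sup>2 + y) * cnj (1 + y) / (norm (1 + y))\<^sup>2"
    using y1 complex_cnj_zero_iff[of "1 + y"] unfolding complex_norm_square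
    by (simp del: complex_cnj_add complex_cnj_zero_iff)
  finally have "Re (cnj z * order_param N z) = Re ((r\<^sup>2 + y) * cnj (1 + y)) / (norm (1 + y))\<^sup>2"
    by (metis Re_divide_of_real)
  also have "Re ((r\<^sup>2 + y) * cnj (1 + y)) = r\<^sup>2 + \<rho>\<^sup>2 + (1 + r\<^sup>2) * Re y"
    unfolding \<rho>_def cmod_power2 by (simp add: power2_eq_square algebra_simps)
  finally have eq: "Re (cnj z * order_param N z) = (r\<^sup>2 + \<rho>\<^sup>2 + (1 + r\<^sup>2) * Re y) / (norm (1 + y))\<^sup>2" .
  have "r\<^sup>2 * (1 - r)\<^sup>2 \<le> (r\<^sup>2 - \<rho>) * (1 - \<rho>)"
  proof -
    have "r\<^sup>2 * (1 - r) * (1 - r) \<le> (r\<^sup>2 - \<rho>) * (1 - \<rho>)"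
      using r \<rho> r3le \<open>\<rho> < 1\<close> power_decreasing[of 2 3 r] unfolding r3 by (intro mult_mono) (auto simp: algebra_simps)
    then show ?thesis by (simp add: power2_eq_square mult.assoc)
  qed
  also have "(r\<^sup>2 - \<rho>) * (1 - \<rho>) = r\<^sup>2 + \<rho>\<^sup>2 + (1 + r\<^sup>2) * (- \<rho>)"
    by (simp add: algebra_simps power2_eq_square)
  also have "\<dots> \<le> r\<^sup>2 + \<rho>\<^sup>2 + (1 + r\<^sup>2) * Re y"
    using abs_Re_le_cmod[of y] by (intro add_left_mono mult_left_mono) (auto simp: \<rho>_def)
  finally have num: "r\<^sup>2 * (1 - r)\<^sup>2 \<le> r\<^sup>2 + \<rho>\<^sup>2 + (1 + r\<^sup>2) * Re y" .
  have "norm (1 + y) \<le> 2" using norm_triangle_ineq[of 1 y] \<open>\<rho> < 1\<close> by (simp add: \<rho>_def)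
  then have den: "(norm (1 + y))\<^sup>2 \<le> 4" using power_mono[of "norm (1 + y)" 2 2] by simp
  have "r\<^sup>2 * (1 - r)\<^sup>2 / 4 \<le> (r\<^sup>2 + \<rho>\<^sup>2 + (1 + r\<^sup>2) * Re y) / (norm (1 + y))\<^sup>2"
    using num den y1 by (intro frac_le) (auto intro: order_trans[OF _ num])
  then show ?thesis using eq by (simp add: r_def)
qed

section \<open>Lifts of Moebius images\<close>

lemma twist_has_derivative:
  assumes Z: "(Z has_derivative Z') (at u within S)" and "norm (Z u) < 1" "norm w = 1"
  shows "((\<lambda>v. twist (Z v) w) has_derivative (\<lambda>h. Im (cnj (Z' h) * w / (1 + cnj (Z u) * w)))) (at u within S)"
proof -
  have "1 + cnj (Z u) * w \<notin> \<real>\<^sub>\<le>\<^sub>0"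
    using mobius_denom_pos[OF assms(2,3)] by (metis complex_nonpos_Reals_iff not_less)
  then have "(Ln has_derivative (*) (inverse (1 + cnj (Z u) * w))) (at (1 + cnj (Z u) * w))"
    using has_field_derivative_Ln by (simp add: has_field_derivative_def)
  moreover have "((\<lambda>v. 1 + cnj (Z v) * w) has_derivative (\<lambda>h. cnj (Z' h) * w)) (at u within S)"
    by (rule has_derivative_eq_rhs, (rule derivative_intros Z bounded_linear.has_derivative[OF bounded_linear_cnj])+) simp
  ultimately have "((\<lambda>v. Ln (1 + cnj (Z v) * w)) has_derivative
      (\<lambda>h. inverse (1 + cnj (Z u) * w) * (cnj (Z' h) * w))) (at u within S)"
    by (rule has_derivative_compose[rotated])
  from bounded_linear.has_derivative[OF bounded_linear_Im this]
  have "((\<lambda>v. Im (Ln (1 + cnj (Z v) * w))) has_derivative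
      (\<lambda>h. Im (cnj (Z' h) * w / (1 + cnj (Z u) * w)))) (at u within S)"
    by (simp add: field_simps)
  then show ?thesis by (simp add: twist_def)
qed

lemma continuous_on_twist:
  assumes "norm w = 1"
  shows "continuous_on (ball 0 1) (\<lambda>z. twist z w)"
proof -
  have "((\<lambda>z. twist z w) has_derivative (\<lambda>h. Im (cnj h * w / (1 + cnj z * w)))) (at z within ball 0 1)"
    if "z \<in> ball 0 1" for z
    using that assms by (intro twist_has_derivative has_derivative_ident) auto
  then show ?thesis by (rule has_derivative_continuous_on)
qed

definition lift :: "nat \<Rightarrow> real \<Rightarrow> complex \<Rightarrow> nat \<Rightarrow> real"
  where "lift N a z i = pi * (2 * real i - 1) / real N + a - 2 * twist z (node N i)"

lemma cis_lift:
  assumes "norm z < 1"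
  shows "cis (lift N a z i) = cis a * mobius z (node N i)"
  using assms by (simp add: mobius_eq_twist) (simp add: node_def lift_def cis_mult algebra_simps)

text \<open>The common rotation \<open>a\<close> cancels in the differences, so the coupling depends
  on \<open>z\<close> alone and the equation for \<open>z\<close> is autonomous.\<close>

lemma sum_circle_sin_lift:
  assumes "norm z < 1" "N > 0"
  shows "(\<Sum>j=1..N. circle_sin (proj (lift N a z j) - proj (lift N a z i)))
    = real N * Im (order_param N z * cnj (mobius z (node N i)))"
proof -
  have "(\<Sum>j=1..N. circle_sin (proj (lift N a z j) - proj (lift N a z i)))
      = Im (\<Sum>j=1..N. cis (lift N a z j) * cnj (cis (lift N a z i)))"
    by (simp add: circle_sin_diff)
  also have "(\<Sum>j=1..N. cis (lift N a z j) * cnj (cis (lift N a z i)))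
      = cis a * cnj (cis a) * (of_nat N * order_param N z * cnj (mobius z (node N i)))"
  proof -
    have "of_nat N * order_param N z = (\<Sum>j=1..N. mobius z (node N j))"
      using assms(2) by (simp add: order_param_def)
    then show ?thesis
      unfolding cis_lift[OF assms(1)]
      by (simp add: sum_distrib_left sum_distrib_right mult_ac del: cis_cnj)
  qed
  also have "\<dots> = of_nat N * (order_param N z * cnj (mobius z (node N i)))"
    by (simp add: cnj_unimodular del: cis_cnj)
  finally show ?thesis by simp
qed

text \<open>The conjugate of \<open>mobius z w\<close> is \<open>cnj z\<close> plus (1 - |z|^2) cnj
  w / (1 + z cnj w). This splits the velocity of each oscillator into a part common to all, which is
  the equation for \<open>a\<close>, and a part produced by the motion of \<open>z\<close>.\<close>

lemma lift_kuramoto_solution: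
  assumes "N > 0"
    and z: "\<And>t. t \<in> J \<Longrightarrow> norm (z t) < 1"
    and z': "\<And>t. t \<in> J \<Longrightarrow> (z has_vector_derivative
      of_real (K / 2 * (1 - (norm (z t))\<^sup>2)) * order_param N (z t)) (at t within J)"
    and a': "\<And>t. t \<in> J \<Longrightarrow> (a has_real_derivative K * Im (cnj (z t) * order_param N (z t))) (at t within J)"
  shows "kuramoto_solution K N J (\<lambda>t. \<lambda>i\<in>{1..N}. proj (lift N (a t) (z t) i))"
  unfolding kuramoto_solution_def
proof (intro ballI conjI)
  fix t i
  assume t: "t \<in> J" and i: "i \<in> {1..N}"
  define H where "H = order_param N (z t)"
  define w where "w = node N i"
  define m where "m = K / 2 * (1 - (norm (z t))\<^sup>2)"
  note zt = z[OF t]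
  have w: "norm w = 1" by (simp add: w_def)
  have "((\<lambda>s. twist (z s) w) has_derivative
      (\<lambda>h. Im (cnj (h *\<^sub>R (of_real m * H)) * w / (1 + cnj (z t) * w)))) (at t within J)"
    using twist_has_derivative[OF z'[OF t, unfolded has_vector_derivative_def] zt w]
    by (simp add: m_def H_def)
  then have d: "((\<lambda>s. lift N (a s) (z s) i) has_derivative
      (\<lambda>h. h * (K * Im (cnj (z t) * H)) - 2 * Im (cnj (h *\<^sub>R (of_real m * H)) * w / (1 + cnj (z t) * w)))) (at t within J)"
    unfolding lift_def w_def[symmetric]
    by (rule has_derivative_eq_rhs[OF has_derivative_diff[OF has_derivative_add[OF has_derivative_const
         a'[OF t, unfolded has_field_derivative_def]] has_derivative_mult_right]])
       (auto simp: H_def algebra_simps)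
  have g: "1 + cnj (z t) * w \<noteq> 0" "1 + z t * cnj w \<noteq> 0"
    using mobius_denom_nonzero[OF zt w] by (metis complex_cnj_add complex_cnj_cnj complex_cnj_mult complex_cnj_one complex_cnj_zero)+
  have key: "cnj (mobius (z t) w) - (1 - z t * cnj (z t)) * (cnj w / (1 + z t * cnj w)) = cnj (z t)"
  proof -
    have "cnj w + cnj (z t) - (1 - z t * cnj (z t)) * cnj w = cnj (z t) * (1 + z t * cnj w)"
      by (simp add: algebra_simps)
    then have "(cnj w + cnj (z t) - (1 - z t * cnj (z t)) * cnj w) / (1 + z t * cnj w) = cnj (z t)"
      by (simp only: nonzero_mult_div_cancel_right[OF g(2)])
    then show ?thesis by (simp add: mobius_def diff_divide_distrib)
  qed
  have "h * (K * Im (cnj (z t) * H)) - 2 * Im (cnj (h *\<^sub>R (of_real m * H)) * w / (1 + cnj (z t) * w))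
      = h * (K * Im (H * cnj (mobius (z t) w)))" for h
  proof -
    define R where "R = cnj w / (1 + z t * cnj w)"
    have "cnj (h *\<^sub>R (of_real m * H)) * w / (1 + cnj (z t) * w) = of_real (h * m) * cnj (H * R)"
      by (simp add: scaleR_conv_of_real R_def)
    then have "- 2 * Im (cnj (h *\<^sub>R (of_real m * H)) * w / (1 + cnj (z t) * w))
        = - 2 * Im (of_real (h * m) * cnj (H * R))" by (simp only:)
    also have "\<dots> = h * (2 * m) * Im (H * R)" by (simp add: algebra_simps)
    also have "\<dots> = h * K * Im (H * (of_real (1 - (norm (z t))\<^sup>2) * R))"
      by (simp add: m_def algebra_simps)
    also have "complex_of_real (1 - (norm (z t))\<^sup>2) = 1 - z t * cnj (z t)"
      unfolding of_real_diff complex_norm_square by simp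
    finally have e: "- 2 * Im (cnj (h *\<^sub>R (of_real m * H)) * w / (1 + cnj (z t) * w))
        = h * K * Im (H * ((1 - z t * cnj (z t)) * R))" .
    have "Im (H * cnj (mobius (z t) w)) = Im (H * ((1 - z t * cnj (z t)) * R)) + Im (H * cnj (z t))"
    proof -
      have "cnj (mobius (z t) w) = (1 - z t * cnj (z t)) * R + cnj (z t)"
        using key unfolding R_def by (metis add.commute diff_add_cancel)
      then show ?thesis by (simp only: distrib_left plus_complex.sel)
    qed
    moreover have "Im (cnj (z t) * H) = Im (H * cnj (z t))" by (simp add: mult.commute)
    ultimately show ?thesis using e by (simp only:) (simp add: algebra_simps)
  qed
  then have "((\<lambda>s. lift N (a s) (z s) i) has_derivative
      (\<lambda>h. h * (K / real N * (\<Sum>j=1..N. circle_sin (proj (lift N (a t) (z t) j) - proj (lift N (a t) (z t) i)))))) (at t within J)"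
    using d unfolding sum_circle_sin_lift[OF zt assms(1)] using assms(1)
    by (simp add: H_def w_def)
  then show "has_circle_derivative (\<lambda>s. (\<lambda>i\<in>{1..N}. proj (lift N (a s) (z s) i)) i)
     (\<lambda>h. h * (K / real N * (\<Sum>j=1..N. circle_sin ((\<lambda>i\<in>{1..N}. proj (lift N (a t) (z t) i)) j -
        (\<lambda>i\<in>{1..N}. proj (lift N (a t) (z t) i)) i)))) t J"
    unfolding has_circle_derivative_def
    by (intro exI[of _ "\<lambda>s. lift N (a s) (z s) i"]) (use i in auto)
qed (auto simp: torus_def)

text \<open>This is the rotation for which the real mean of the lifts is exactly \<open>b\<close>
  (\<open>mean_lift\<close>); the term pi is the mean of the base angles.\<close>

definition disc_phase :: "nat \<Rightarrow> real \<Rightarrow> complex \<Rightarrow> real"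
  where "disc_phase N b z = b - pi + 2 / real N * (\<Sum>j=1..N. twist z (node N j))"

definition disc_point :: "nat \<Rightarrow> real \<Rightarrow> complex \<Rightarrow> nat \<Rightarrow> circle"
  where "disc_point N b z = (\<lambda>i\<in>{1..N}. proj (lift N (disc_phase N b z) z i))"

lemma disc_phase_has_derivative:
  assumes Z: "(Z has_derivative Z') (at u within S)" and "norm (Z u) < 1"
  shows "((\<lambda>v. disc_phase N b (Z v)) has_derivative
    (\<lambda>h. 2 / real N * (\<Sum>j=1..N. Im (cnj (Z' h) * node N j / (1 + cnj (Z u) * node N j))))) (at u within S)"
proof -
  have "((\<lambda>v. \<Sum>j=1..N. twist (Z v) (node N j)) has_derivative
    (\<lambda>h. \<Sum>j=1..N. Im (cnj (Z' h) * node N j / (1 + cnj (Z u) * node N j)))) (at u within S)"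
    by (intro has_derivative_sum twist_has_derivative assms) simp
  note * = has_derivative_add[OF has_derivative_const has_derivative_mult_right[OF this]]
  show ?thesis unfolding disc_phase_def by (rule has_derivative_eq_rhs, rule *) simp
qed

text \<open>Conservation of the mean phase, in disc coordinates: the derivative comes out as K Im
  (cnj H (H - z)), in which cnj H H is real.\<close>

lemma disc_phase_flow:
  assumes "N > 0" "norm (z t) < 1"
    and z': "(z has_vector_derivative of_real (K / 2 * (1 - (norm (z t))\<^sup>2)) * order_param N (z t)) (at t within J)"
  shows "((\<lambda>s. disc_phase N b (z s)) has_real_derivative K * Im (cnj (z t) * order_param N (z t))) (at t within J)"
proof -
  define H where "H = order_param N (z t)"
  define m where "m = 1 - (norm (z t))\<^sup>2"
  define W where "W = (\<Sum>j=1..N. node N j / (1 + cnj (z t) * node N j))"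
  have H: "of_real m * W / of_nat N = H - z t"
    using order_param_expansion[OF assms(1,2)] by (simp add: H_def m_def W_def)
  have "2 / real N * (\<Sum>j=1..N. Im (cnj (h *\<^sub>R (of_real (K / 2 * m) * H)) * node N j / (1 + cnj (z t) * node N j)))
      = h * (K * Im (cnj (z t) * H))" for h
  proof -
    have "(\<Sum>j=1..N. Im (cnj (h *\<^sub>R (of_real (K / 2 * m) * H)) * node N j / (1 + cnj (z t) * node N j)))
      = Im (of_real (h * K / 2) * (cnj H * (of_real m * W)))"
      unfolding W_def Im_sum[symmetric] sum_distrib_left
      by (intro arg_cong[of _ _ Im] sum.cong) (simp_all add: scaleR_conv_of_real)
    also have "of_real m * W = of_nat N * (H - z t)" using H assms(1) by (simp add: field_simps)
    also have "cnj H * (of_nat N * (H - z t)) = of_nat N * (cnj H * H - cnj H * z t)"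
      by (simp add: algebra_simps)
    also have "Im (of_real (h * K / 2) * \<dots>) = h * K / 2 * (real N * Im (cnj (z t) * H))"
      unfolding times_complex.sel by (simp add: mult.commute)
    finally have e: "(\<Sum>j=1..N. Im (cnj (h *\<^sub>R (of_real (K / 2 * m) * H)) * node N j / (1 + cnj (z t) * node N j)))
      = h * K / 2 * (real N * Im (cnj (z t) * H))" .
    show ?thesis unfolding e using assms(1) by simp
  qed
  then show ?thesis
    using disc_phase_has_derivative[OF z'[unfolded has_vector_derivative_def] assms(2), of N b]
    by (simp add: has_field_derivative_def m_def H_def mult_commute_abs)
qed

lemma disc_point_kuramoto_solution:
  assumes "N > 0"
    and z: "\<And>t. t \<in> J \<Longrightarrow> norm (z t) < 1"
    and z': "\<And>t. t \<in> J \<Longrightarrow> (z has_vector_derivative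
      of_real (K / 2 * (1 - (norm (z t))\<^sup>2)) * order_param N (z t)) (at t within J)"
  shows "kuramoto_solution K N J (\<lambda>t. disc_point N b (z t))"
  unfolding disc_point_def
  by (intro lift_kuramoto_solution assms disc_phase_flow)

lemma continuous_on_disc_point: "continuous_on (ball 0 1) (disc_point N b)"
proof (rule continuous_on_coordinatewise_then_product)
  fix i
  show "continuous_on (ball 0 1) (\<lambda>z. disc_point N b z i)"
  proof (cases "i \<in> {1..N}")
    case True
    then show ?thesis unfolding disc_point_def restrict_apply' [OF True] lift_def disc_phase_def
      by (intro continuous_intros continuous_on_twist) auto
  next
    case False
    then have "disc_point N b z i = undefined" for z by (auto simp: disc_point_def)
    then show ?thesis by simp
  qed
qed

section \<open>The flow on the disc\<close>

text \<open>With the larger modulus in the denominator, the change of the numerator contributes 2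
  and that of the denominator 1. The default value 0 of the quotient at 0 is also its limit.\<close>

lemma norm_cnj_sq_div_diff_le:
  fixes a b :: complex
  shows "norm ((cnj a)\<^sup>2 / a - (cnj b)\<^sup>2 / b) \<le> 3 * norm (a - b)"
proof -
  have *: "norm ((cnj a)\<^sup>2 / a - (cnj b)\<^sup>2 / b) \<le> 3 * norm (a - b)"
    if le: "norm b \<le> norm a" for a b :: complex
  proof (cases "b = 0")
    case True
    then show ?thesis by (cases "a = 0") (auto simp: norm_divide norm_mult norm_power power2_eq_square)
  next
    case False
    with le have nz: "a \<noteq> 0" "b \<noteq> 0" by auto
    have "(cnj a)\<^sup>2 / a - (cnj b)\<^sup>2 / b = cnj (a - b) * (cnj a + cnj b) / a - (cnj b)\<^sup>2 * (a - b) / (a * b)"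
      using nz by (simp add: field_simps power2_eq_square)
    then have "norm ((cnj a)\<^sup>2 / a - (cnj b)\<^sup>2 / b)
        \<le> norm (cnj (a - b) * (cnj a + cnj b) / a) + norm ((cnj b)\<^sup>2 * (a - b) / (a * b))"
      by (simp only: norm_triangle_ineq4)
    also have "norm (cnj (a - b) * (cnj a + cnj b) / a) \<le> 2 * norm (a - b)"
    proof -
      have "norm (cnj a + cnj b) \<le> 2 * norm a"
        using le norm_triangle_ineq[of "cnj a" "cnj b"] by simp
      then have "norm (a - b) * norm (cnj a + cnj b) \<le> norm (a - b) * (2 * norm a)"
        by (intro mult_left_mono) auto
      then show ?thesis
        using nz by (simp add: norm_divide norm_mult divide_le_eq mult_ac flip: complex_cnj_diff)
    qed
    also have "norm ((cnj b)\<^sup>2 * (a - b) / (a * b)) \<le> norm (a - b)"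
    proof -
      have "norm ((cnj b)\<^sup>2 * (a - b) / (a * b)) = norm b / norm a * norm (a - b)"
        using nz by (simp add: norm_divide norm_mult norm_power power2_eq_square)
      also have "\<dots> \<le> 1 * norm (a - b)"
        using le nz by (intro mult_right_mono) auto
      finally show ?thesis by simp
    qed
    finally show ?thesis by simp
  qed
  show ?thesis
  proof (cases "norm b \<le> norm a")
    case False
    then show ?thesis using *[of a b] by (simp add: norm_minus_commute)
  qed (rule *)
qed

text \<open>With \<open>g = 1 + cnj z * w\<close> one has \<open>w + z = w * cnj g\<close> and \<open>1 - |z|\<^sup>2 = g + cnj g - g * cnj g\<close>,
  so the product is \<open>w * (cnj g + (cnj g)\<^sup>2 / g - (cnj g)\<^sup>2)\<close>: no singularity is left on the circle
  beyond that of the Lipschitz function \<open>(cnj g)\<^sup>2 / g\<close>.\<close>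

lemma mobius_field_lipschitz:
  assumes w: "norm w = 1" and z: "norm z \<le> 1" "norm z' \<le> 1"
  shows "norm ((1 - (norm z)\<^sup>2) * mobius z w - (1 - (norm z')\<^sup>2) * mobius z' w) \<le> 8 * norm (z - z')"
proof -
  define g where "g z = 1 + cnj z * w" for z
  have eq: "(1 - (norm z)\<^sup>2) * mobius z w = w * (cnj (g z) + (cnj (g z))\<^sup>2 / g z - (cnj (g z))\<^sup>2)" for z
  \<comment> \<open>At this boundary point the left side vanishes through its first factor, the
    right side through \<open>cnj (g z) = 0\<close> and the default value of division.\<close>
  proof (cases "g z = 0")
    case True
    then have "cnj z * w = - 1" by (simp add: g_def add_eq_0_iff)
    then have "norm z = 1" using w by (metis norm_mult complex_mod_cnj norm_minus_cancel norm_one mult.right_neutral)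
    then show ?thesis using True by simp
  next
    case False
    have 1: "w + z = w * cnj (g z)" using cnj_unimodular[OF w] by (simp add: g_def algebra_simps)
    have 2: "complex_of_real (1 - (norm z)\<^sup>2) = g z + cnj (g z) - g z * cnj (g z)"
      unfolding of_real_diff complex_norm_square g_def using cnj_unimodular[OF w]
      by (simp, algebra)
    have 3: "mobius z w = w * cnj (g z) / g z" unfolding mobius_def 1 by (simp add: g_def)
    show ?thesis unfolding 2 3 using False by (simp add: field_simps power2_eq_square)
  qed
  have d: "norm (g z - g z') = norm (z - z')"
    using w by (simp add: g_def norm_mult flip: left_diff_distrib complex_cnj_diff)
  have b: "norm (g z) \<le> 2" if "norm z \<le> 1" for z
    using norm_triangle_ineq[of 1 "cnj z * w"] that w by (simp add: g_def norm_mult)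
  have "norm ((1 - (norm z)\<^sup>2) * mobius z w - (1 - (norm z')\<^sup>2) * mobius z' w)
      = norm (cnj (g z - g z') + ((cnj (g z))\<^sup>2 / g z - (cnj (g z'))\<^sup>2 / g z')
          - cnj ((g z - g z') * (g z + g z')))"
    unfolding eq right_diff_distrib[symmetric] norm_mult w
    by (simp add: algebra_simps power2_eq_square)
  \<comment> \<open>The three terms contribute 1 + 3 + 4 = 8; the 4 bounds |g z + g z'|.\<close>
  also have "\<dots> \<le> norm (g z - g z') + 3 * norm (g z - g z') + norm (g z - g z') * 4"
  proof -
    have "norm (g z + g z') \<le> 4" using norm_triangle_ineq[of "g z" "g z'"] b[OF z(1)] b[OF z(2)] by linarith
    then have "norm (cnj ((g z - g z') * (g z + g z'))) \<le> norm (g z - g z') * 4"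
      unfolding complex_mod_cnj norm_mult by (intro mult_left_mono) auto
    moreover have "norm (cnj (g z - g z')) = norm (g z - g z')" by (rule complex_mod_cnj)
    ultimately show ?thesis
      using norm_cnj_sq_div_diff_le[of "g z" "g z'"]
      by (intro order_trans[OF norm_triangle_ineq4] order_trans[OF add_right_mono[OF norm_triangle_ineq]]) linarith
  qed
  finally show ?thesis by (simp add: d)
qed

definition disc_field :: "real \<Rightarrow> nat \<Rightarrow> complex \<Rightarrow> complex"
  where "disc_field K N z = of_real (K / 2 * (1 - (norm z)\<^sup>2)) * order_param N z"

lemma disc_field_lipschitz:
  assumes "K > 0" "N > 0" "norm z \<le> 1" "norm z' \<le> 1"
  shows "dist (disc_field K N z) (disc_field K N z') \<le> 4 * K * dist z z'"
proof -
  let ?f = "\<lambda>z j. (1 - (norm z)\<^sup>2) * mobius z (node N j)"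
  have e: "disc_field K N z = of_real (K / (2 * N)) * (\<Sum>j=1..N. ?f z j)" for z
    by (simp add: disc_field_def order_param_def flip: sum_distrib_left)
  have "norm (\<Sum>j=1..N. ?f z j - ?f z' j) \<le> (\<Sum>j=1..N. 8 * norm (z - z'))"
    by (intro sum_norm_le mobius_field_lipschitz assms) simp
  then have "K / (2 * N) * norm (\<Sum>j=1..N. ?f z j - ?f z' j) \<le> K / (2 * N) * (real N * (8 * norm (z - z')))"
    using assms by (intro mult_left_mono) auto
  moreover have a: "norm (complex_of_real (K / (2 * N))) = K / (2 * N)"
    using assms by (simp only: norm_of_real) simp
  have "dist (disc_field K N z) (disc_field K N z') = K / (2 * N) * norm (\<Sum>j=1..N. ?f z j - ?f z' j)"
    unfolding e dist_norm right_diff_distrib[symmetric] sum_subtractf[symmetric] norm_mult a ..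
  ultimately show ?thesis using assms by (simp add: dist_norm)
qed

text \<open>Composing the field with the nearest-point projection onto the closed disc makes it
  Lipschitz on the plane. Along the resulting curve \<rho> = 1 - |z|^2 grows at most linearly in
  itself, so it never reaches 0 and the projection is never felt.\<close>

lemma disc_flow_exists:
  assumes K: "K > 0" and N: "N > 0" and z0: "norm z0 < 1"
  obtains z where "z 0 = z0" "\<And>t. norm (z t) < 1"
    "\<And>t. (z has_vector_derivative disc_field K N (z t)) (at t)"
proof -
  define c where "c = closest_point (cball (0::complex) 1)"
  have c: "norm (c x) \<le> 1" for x
    using closest_point_in_set[of "cball (0::complex) 1" x] by (simp add: c_def)
  have c_id: "c x = x" if "norm x \<le> 1" for x
    using that closest_point_self[of x "cball 0 1"] by (simp add: c_def)
  have c_bd: "norm (c x) = 1" if "norm x \<ge> 1" for x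
  proof -
    have nz: "x \<noteq> 0" using that by auto
    have "norm x - norm (c x) \<le> dist x (c x)" by (simp add: dist_norm norm_triangle_ineq2)
    also have "\<dots> \<le> dist x (x /\<^sub>R norm x)"
      unfolding c_def by (rule closest_point_le) (use nz in auto)
    also have "x - x /\<^sub>R norm x = (1 - inverse (norm x)) *\<^sub>R x" by (simp add: algebra_simps)
    then have "dist x (x /\<^sub>R norm x) = (1 - inverse (norm x)) * norm x"
      using nz that by (simp add: dist_norm inverse_le_1_iff)
    also have "\<dots> = norm x - 1" using nz by (simp add: left_diff_distrib)
    finally show ?thesis using c[of x] by simp
  qed
  have "dist (disc_field K N (c x)) (disc_field K N (c y)) \<le> 4 * K * dist x y" for x y
  proof -
    have "dist (disc_field K N (c x)) (disc_field K N (c y)) \<le> 4 * K * dist (c x) (c y)"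
      by (intro disc_field_lipschitz K N c)
    also have "dist (c x) (c y) \<le> dist x y"
      unfolding c_def by (rule closest_point_lipschitz) auto
    finally show ?thesis using K by simp
  qed
  from picard_global[of "\<lambda>x. disc_field K N (c x)", OF this, of z0] obtain z where
    z: "z 0 = z0" "\<And>t. (z has_vector_derivative disc_field K N (c (z t))) (at t)" by auto
  define \<rho> where "\<rho> t = 1 - (norm (z t))\<^sup>2" for t
  have \<rho>: "(\<rho> has_vector_derivative - 2 * (z t \<bullet> disc_field K N (c (z t)))) (at t)" for t
    unfolding \<rho>_def power2_norm_eq_inner has_vector_derivative_def
    by (rule has_derivative_eq_rhs,
        rule has_derivative_diff[OF has_derivative_const has_derivative_inner[OF z(2)[unfolded has_vector_derivative_def] z(2)[unfolded has_vector_derivative_def]]])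
       (auto simp: inner_commute algebra_simps)
  have bound: "norm (- 2 * (z t \<bullet> disc_field K N (c (z t)))) \<le> K * norm (\<rho> t)" for t
  proof (cases "norm (z t) < 1")
    case True
    then have "norm (disc_field K N (c (z t))) = K / 2 * \<bar>1 - (norm (z t))\<^sup>2\<bar> * norm (order_param N (z t))"
      using K unfolding disc_field_def norm_mult norm_of_real abs_mult by (simp add: c_id)
    then have "norm (disc_field K N (c (z t))) \<le> K / 2 * \<bar>1 - (norm (z t))\<^sup>2\<bar> * 1"
      using K norm_order_param_le[OF True, of N] by (simp only:) (intro mult_left_mono, auto)
    then have "norm (z t) * norm (disc_field K N (c (z t))) \<le> 1 * (K / 2 * \<bar>1 - (norm (z t))\<^sup>2\<bar> * 1)"
      using True by (intro mult_mono) auto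
    then have "\<bar>z t \<bullet> disc_field K N (c (z t))\<bar> \<le> K / 2 * \<bar>\<rho> t\<bar>"
      using Cauchy_Schwarz_ineq2[of "z t" "disc_field K N (c (z t))"] unfolding \<rho>_def by linarith
    then show ?thesis by (simp add: abs_mult)
  next
    \<comment> \<open>Here the projection lands on the unit circle, where the field is 0.\<close>
    case False
    then show ?thesis using K c_bd[of "z t"] by (simp add: disc_field_def)
  qed
  have pos0: "\<rho> 0 > 0" using z0 z(1) by (simp add: \<rho>_def abs_square_less_1 power2_less_1_iff)
  have nz: "\<rho> t \<noteq> 0" for t
    by (rule linear_growth_nonvanishing[OF \<rho> bound, of 0]) (use pos0 in auto)
  have cont: "continuous_on UNIV \<rho>"
    using \<rho> by (meson continuous_at_imp_continuous_on has_vector_derivative_continuous)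
  have "\<rho> t > 0" for t
  proof (rule ccontr)
    assume "\<not> \<rho> t > 0"
    then have "\<rho> t \<le> 0" "0 \<le> \<rho> 0" using pos0 by auto
    moreover have "connected (range \<rho>)" by (rule connected_continuous_image[OF cont]) simp
    ultimately have "0 \<in> range \<rho>" by (meson connectedD_interval rangeI)
    then show False using nz by auto
  qed
  then have lt: "norm (z t) < 1" for t
    by (simp add: \<rho>_def abs_square_less_1 power2_less_1_iff)
  then have "(z has_vector_derivative disc_field K N (z t)) (at t)" for t
    using z(2)[of t] by (simp add: c_id less_imp_le)
  with z(1) lt show ?thesis by (rule that)
qed

text \<open>The bound of \<open>Re_order_param_ge\<close> degenerates near the circle. But |z|^2 is
  monotone, so |z| stays below its value \<open>b\<close> at time 0 for all negative times; there
  the growth rate is at least the constant \<open>c\<close>.\<close>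

lemma disc_flow_tendsto_0:
  assumes K: "K > 0" and N: "N \<ge> 3" and lt: "\<And>t. norm (z t) < 1"
    and d: "\<And>t. (z has_vector_derivative disc_field K N (z t)) (at t)"
  shows "(z \<longlongrightarrow> 0) at_bot"
proof -
  define r where "r t = (norm (z t))\<^sup>2" for t
  define r' where "r' t = K * (1 - r t) * Re (cnj (z t) * order_param N (z t))" for t
  have r': "(r has_real_derivative r' t) (at t)" for t
    unfolding r_def power2_norm_eq_inner has_field_derivative_def
    by (rule has_derivative_eq_rhs,
        rule has_derivative_inner[OF d[unfolded has_vector_derivative_def] d[unfolded has_vector_derivative_def]])
       (auto simp: r'_def r_def disc_field_def inner_complex_def algebra_simps)
  define b where "b = norm (z 0)"
  define c where "c = K * (1 - b\<^sup>2) * ((1 - b)\<^sup>2 / 4)"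
  have b: "0 \<le> b" "b < 1" using lt by (auto simp: b_def)
  then have b2: "b\<^sup>2 < 1" by (simp add: abs_square_less_1)
  have c: "c > 0" using K b b2 by (simp add: c_def)
  have r1: "r t < 1" for t using lt by (simp add: r_def abs_square_less_1)
  have re: "Re (cnj (z t) * order_param N (z t)) \<ge> r t * (1 - norm (z t))\<^sup>2 / 4" for t
    using Re_order_param_ge[OF N lt] by (simp add: r_def)
  have "r' t \<ge> 0" for t
  proof -
    have "0 \<le> r t * (1 - norm (z t))\<^sup>2 / 4" by (simp add: r_def)
    then show ?thesis unfolding r'_def using re[of t] r1[of t] K by (intro mult_nonneg_nonneg) auto
  qed
  then have mono: "r s \<le> r t" if "s \<le> t" for s t
    using DERIV_nonneg_imp_nondecreasing[OF that, of r] r' by blast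
  have low: "r' t \<ge> c * r t" if "t \<le> 0" for t
  proof -
    have rb: "r t \<le> b\<^sup>2" using mono[OF that] by (simp add: r_def b_def)
    then have nb: "norm (z t) \<le> b" unfolding r_def using b(1) by (rule power2_le_imp_le)
    have "K * (1 - b\<^sup>2) * (r t * (1 - b)\<^sup>2 / 4) \<le> r' t"
      unfolding r'_def
    proof (intro mult_mono order_trans[OF _ re[of t]])
      show "r t * (1 - b)\<^sup>2 / 4 \<le> r t * (1 - norm (z t))\<^sup>2 / 4"
        using nb b by (intro divide_right_mono mult_left_mono power_mono) (auto simp: r_def)
    qed (use K rb b2 r1[of t] in \<open>auto simp: r_def\<close>)
    then show ?thesis by (simp add: c_def mult_ac)
  qed
  have lim: "((\<lambda>t. r 0 * exp (c * t)) \<longlongrightarrow> 0) at_bot"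
  proof -
    have "filterlim (\<lambda>t. c * t) at_bot at_bot"
      by (rule filterlim_tendsto_pos_mult_at_bot[OF tendsto_const c filterlim_ident])
    then have "((\<lambda>t. exp (c * t)) \<longlongrightarrow> 0) at_bot"
      by (rule filterlim_compose[OF exp_at_bot])
    then show ?thesis by (rule tendsto_mult_right_zero)
  qed
  have "r t \<le> r 0 * exp (c * t)" if "t \<le> 0" for t
  proof -
    have "r t * exp (- c * t) \<le> r 0 * exp (- c * 0)"
    proof (rule DERIV_nonneg_imp_nondecreasing[OF that, of "\<lambda>t. r t * exp (- c * t)"])
      fix x :: real
      assume "x \<le> 0"
      have "((\<lambda>t. r t * exp (- c * t)) has_real_derivative (r' x - c * r x) * exp (- c * x)) (at x)"
        by (rule derivative_eq_intros r' refl)+ (simp add: algebra_simps)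
      then show "\<exists>y. ((\<lambda>t. r t * exp (- c * t)) has_real_derivative y) (at x) \<and> 0 \<le> y"
        using low[OF \<open>x \<le> 0\<close>] by (intro exI conjI) auto
    qed
    from mult_right_mono[OF this, of "exp (c * t)"] show ?thesis
      by (simp add: mult.assoc flip: exp_add)
  qed
  then have ev: "eventually (\<lambda>t. r t \<le> r 0 * exp (c * t)) at_bot"
    using eventually_mono[OF eventually_le_at_bot[of "0::real"]] by simp
  have "eventually (\<lambda>t. 0 \<le> r t) at_bot" by (simp add: r_def)
  then have "(r \<longlongrightarrow> 0) at_bot"
    using ev lim by (rule tendsto_sandwich[OF _ _ tendsto_const])
  then have "((\<lambda>t. sqrt (r t)) \<longlongrightarrow> sqrt 0) at_bot" by (rule tendsto_real_sqrt)
  then show ?thesis by (simp add: r_def tendsto_norm_zero_iff)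
qed

section \<open>The disc lies in the unstable manifold\<close>

lemma incoherent_state_eq_disc_point:
  assumes "N > 0"
  shows "incoherent_state N (proj b) = disc_point N b 0"
proof -
  have "pi * (2 * real i - 1 - real N) / real N + b = lift N (disc_phase N b 0) 0 i" for i
    using assms by (simp add: lift_def disc_phase_def twist_def field_simps)
  then show ?thesis
    unfolding incoherent_state_def disc_point_def proj_add[symmetric] by simp
qed

lemma disc_point_in_torus: "disc_point N b z \<in> torus N"
  by (auto simp: disc_point_def torus_def)

lemma circle_cis_disc_point:
  assumes "i \<in> {1..N}" "norm z < 1"
  shows "circle_cis (disc_point N b z i) = cis (disc_phase N b z) * mobius z (node N i)"
  using assms by (simp add: disc_point_def cis_lift)

lemma disc_point_in_unstable_manifold:
  assumes "K > 0" "N \<ge> 3" "norm z0 < 1"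
  shows "disc_point N b z0 \<in> unstable_manifold K N (incoherent_state N (proj b))"
proof -
  obtain z where z: "z 0 = z0" "\<And>t. norm (z t) < 1"
    "\<And>t. (z has_vector_derivative disc_field K N (z t)) (at t)"
    using disc_flow_exists[of K N z0] assms by auto
  have "(z \<longlongrightarrow> 0) at_bot" by (rule disc_flow_tendsto_0[OF assms(1,2) z(2,3)])
  then have "((\<lambda>t. disc_point N b (z t)) \<longlongrightarrow> disc_point N b 0) at_bot"
    using z(2) by (intro continuous_on_tendsto_compose[OF continuous_on_disc_point]) auto
  moreover have "kuramoto_solution K N UNIV (\<lambda>t. disc_point N b (z t))"
    using z(2,3) assms by (intro disc_point_kuramoto_solution) (auto simp: disc_field_def)
  ultimately show ?thesis
    unfolding unstable_manifold_def incoherent_state_eq_disc_point[OF order_less_le_trans[OF _ assms(2)], simplified]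
    using z(1) by (auto simp: disc_point_in_torus intro!: exI[of _ "\<lambda>t. disc_point N b (z t)"])
qed

section \<open>Trajectories emanating from the incoherent state\<close>

lemma continuous_on_mobius:
  assumes "norm x = 1"
  shows "continuous_on (ball 0 1) (\<lambda>z. mobius z x)"
  unfolding mobius_def using mobius_denom_nonzero[OF _ assms] by (intro continuous_intros) auto

locale kuramoto_unstable =
  fixes K :: real and N :: nat and b :: real and \<theta> :: "real \<Rightarrow> nat \<Rightarrow> circle"
  assumes K: "K > 0" and N: "N \<ge> 3"
    and sol: "kuramoto_solution K N UNIV \<theta>"
    and lim: "(\<theta> \<longlongrightarrow> incoherent_state N (proj b)) at_bot"
begin

definition v :: "nat \<Rightarrow> real \<Rightarrow> complex"
  where "v i t = circle_cis (\<theta> t i)"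

definition \<kappa> :: complex
  where "\<kappa> = of_real (K / 2)"

definition Z :: "real \<Rightarrow> complex"
  where "Z t = (\<Sum>j=1..N. v j t) / of_nat N"

abbreviation "w \<equiv> node N"

lemma norm_v [simp]: "norm (v i t) = 1"
  by (simp add: v_def)

lemma norm_Z: "norm (Z t) \<le> 1"
proof -
  have "norm (\<Sum>j=1..N. v j t) \<le> (\<Sum>j=1..N. 1)" by (intro sum_norm_le) simp
  then show ?thesis using N by (simp add: Z_def norm_divide)
qed

lemma sum_v: "(\<Sum>j=1..N. v j t) = of_nat N * Z t"
  using N by (simp add: Z_def)

lemma v_rate:
  assumes "i \<in> {1..N}"
  shows "(v i has_vector_derivative of_real (K * Im (Z t * cnj (v i t))) * \<i> * v i t) (at t)"
proof -
  have "K / real N * (\<Sum>j=1..N. circle_sin (\<theta> t j - \<theta> t i)) = K * Im (Z t * cnj (v i t))"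
  proof -
    have "(\<Sum>j=1..N. circle_sin (\<theta> t j - \<theta> t i)) = Im ((\<Sum>j=1..N. v j t) * cnj (v i t))"
      by (simp only: circle_sin_diff v_def Im_sum[symmetric] sum_distrib_right)
    also have "\<dots> = real N * Im (Z t * cnj (v i t))"
      unfolding sum_v mult.assoc by simp
    finally show ?thesis using N by simp
  qed
  moreover have "has_circle_derivative (\<lambda>s. \<theta> s i)
      (\<lambda>h. h * (K / real N * (\<Sum>j=1..N. circle_sin (\<theta> t j - \<theta> t i)))) t UNIV"
    using sol assms by (auto simp: kuramoto_solution_def)
  ultimately show ?thesis
    using has_circle_derivative_cis unfolding v_def by metis
qed

text \<open>Writing \<open>2 * \<i> * Im x\<close> as \<open>x - cnj x\<close> and using
  \<open>v * cnj v = 1\<close> leaves a quadratic field in \<open>v i t\<close> whose coefficients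
  do not depend on \<open>i\<close>. Hence differences of coordinates obey linear equations, see
  \<open>diff_rate\<close>.\<close>

lemma v_riccati:
  assumes "i \<in> {1..N}"
  shows "(v i has_vector_derivative \<kappa> * (Z t - cnj (Z t) * (v i t)\<^sup>2)) (at t)"
proof -
  have c: "v i t * cnj (v i t) = 1" by (simp add: cnj_unimodular)
  have "of_real K * (complex_of_real (Im x) * \<i>) = \<kappa> * (x - cnj x)" for x
    by (simp add: complex_diff_cnj \<kappa>_def)
  from this[of "Z t * cnj (v i t)"]
  have "of_real (K * Im (Z t * cnj (v i t))) * \<i> = \<kappa> * (Z t * cnj (v i t) - cnj (Z t) * v i t)"
    by (simp only: of_real_mult complex_cnj_mult complex_cnj_cnj mult.assoc)
  then have "of_real (K * Im (Z t * cnj (v i t))) * \<i> * v i t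
      = \<kappa> * (Z t * (v i t * cnj (v i t)) - cnj (Z t) * (v i t)\<^sup>2)"
    by (simp only:) (simp add: algebra_simps power2_eq_square)
  then show ?thesis using v_rate[OF assms, of t] c by simp
qed

lemma v_continuous: "i \<in> {1..N} \<Longrightarrow> continuous_on UNIV (v i)"
  using v_rate by (meson continuous_at_imp_continuous_on has_vector_derivative_continuous)

lemma v_lim:
  assumes "i \<in> {1..N}"
  shows "(v i \<longlongrightarrow> cis (b - pi) * w i) at_bot"
proof -
  have "continuous_on UNIV (\<lambda>x::nat \<Rightarrow> circle. circle_cis (x i))"
    by (rule continuous_on_compose2[OF continuous_on_circle_cis continuous_on_product_coordinates]) auto
  then have "(v i \<longlongrightarrow> circle_cis (incoherent_state N (proj b) i)) at_bot"
    unfolding v_def by (rule continuous_on_tendsto_compose[OF _ lim]) auto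
  also have "circle_cis (incoherent_state N (proj b) i) = cis (b - pi) * w i"
    using N assms circle_cis_disc_point[OF assms, of 0 b]
    by (simp add: incoherent_state_eq_disc_point) (simp add: disc_phase_def twist_def)
  finally show ?thesis .
qed

lemma diff_rate:
  assumes "i \<in> {1..N}" "j \<in> {1..N}"
  shows "((\<lambda>t. v i t - v j t) has_vector_derivative
    - \<kappa> * cnj (Z t) * (v i t + v j t) * (v i t - v j t)) (at t)"
  by (rule has_vector_derivative_eq_rhs[OF has_vector_derivative_diff[OF v_riccati[OF assms(1)] v_riccati[OF assms(2)]]])
     (simp add: algebra_simps power2_eq_square)

text \<open>The limits differ, so the coordinates differ at some early time, and the linear equation
  of their difference keeps them apart.\<close>

lemma v_distinct:
  assumes ij: "i \<in> {1..N}" "j \<in> {1..N}" "i \<noteq> j"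
  shows "v i t \<noteq> v j t"
proof -
  have "((\<lambda>t. v i t - v j t) \<longlongrightarrow> cis (b - pi) * w i - cis (b - pi) * w j) at_bot"
    by (intro tendsto_diff v_lim ij)
  moreover have "cis (b - pi) * w i - cis (b - pi) * w j \<noteq> 0"
    using node_inject[OF ij(1,2)] ij(3) by simp
  ultimately have "eventually (\<lambda>t. v i t - v j t \<noteq> 0) at_bot"
    by (rule tendsto_imp_eventually_ne)
  then obtain s where s: "v i s - v j s \<noteq> 0"
    by (meson eventually_happens trivial_limit_at_bot_linorder)
  have "v i t - v j t \<noteq> 0"
  proof (rule linear_growth_nonvanishing[OF diff_rate[OF ij(1,2)] _ s])
    fix t
    have "norm (v i t + v j t) \<le> 2" using norm_triangle_ineq[of "v i t" "v j t"] by simp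
    then have "norm (Z t) * norm (v i t + v j t) \<le> 1 * 2" by (intro mult_mono norm_Z) auto
    then have "K / 2 * (norm (Z t) * norm (v i t + v j t)) * norm (v i t - v j t) \<le> K / 2 * 2 * norm (v i t - v j t)"
      using K by (intro mult_right_mono mult_left_mono) auto
    moreover have "norm (- \<kappa> * cnj (Z t) * (v i t + v j t) * (v i t - v j t))
      = K / 2 * (norm (Z t) * norm (v i t + v j t)) * norm (v i t - v j t)"
      using K by (simp add: norm_mult \<kappa>_def norm_divide)
    ultimately show "norm (- \<kappa> * cnj (Z t) * (v i t + v j t) * (v i t - v j t)) \<le> K * norm (v i t - v j t)"
      by simp
  qed
  then show ?thesis by simp
qed

text \<open>Both products obey the same scalar linear equation, so a linear combination of them that
  vanishes at one time vanishes at all times.\<close>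

lemma cross_products_proportional:
  assumes "i \<in> {1..N}" "j \<in> {1..N}" "k \<in> {1..N}" "l \<in> {1..N}"
  defines "X \<equiv> \<lambda>t. (v i t - v j t) * (v k t - v l t)"
    and "Y \<equiv> \<lambda>t. (v i t - v k t) * (v j t - v l t)"
  shows "X t * Y s = X s * Y t"
proof (rule ccontr)
  assume neq: "X t * Y s \<noteq> X s * Y t"
  \<comment> \<open>The rates of the two factors add up; for \<open>X\<close> the indices pair as
    ij, kl and for \<open>Y\<close> as ik, jl, with the same total.\<close>
  define a where "a t = - \<kappa> * cnj (Z t) * (v i t + v j t + v k t + v l t)" for t
  define E where "E t = X t * Y s - X s * Y t" for t
  have X: "(X has_vector_derivative a t * X t) (at t)" for t
    unfolding X_def a_def
    by (rule has_vector_derivative_eq_rhs[OF has_vector_derivative_mult[OF diff_rate[OF assms(1,2)] diff_rate[OF assms(3,4)]]])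
       (simp add: algebra_simps)
  have Y: "(Y has_vector_derivative a t * Y t) (at t)" for t
    unfolding Y_def a_def
    by (rule has_vector_derivative_eq_rhs[OF has_vector_derivative_mult[OF diff_rate[OF assms(1,3)] diff_rate[OF assms(2,4)]]])
       (simp add: algebra_simps)
  have E: "(E has_vector_derivative a t * E t) (at t)" for t
    unfolding E_def
    by (rule has_vector_derivative_eq_rhs[OF has_vector_derivative_diff[OF has_vector_derivative_mult_left[OF X] has_vector_derivative_mult_right[OF Y]]])
       (simp add: algebra_simps)
  have "norm (a t) \<le> 2 * K" for t
  proof -
    have "norm (v i t + v j t + v k t + v l t) \<le> 4"
      using norm_triangle_ineq[of "v i t + v j t + v k t" "v l t"]
        norm_triangle_ineq[of "v i t + v j t" "v k t"] norm_triangle_ineq[of "v i t" "v j t"] by simp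
    then have "norm (Z t) * norm (v i t + v j t + v k t + v l t) \<le> 1 * 4" by (intro mult_mono norm_Z) auto
    then have "K / 2 * (norm (Z t) * norm (v i t + v j t + v k t + v l t)) \<le> K / 2 * 4"
      using K by (intro mult_left_mono) auto
    then show ?thesis using K by (simp add: a_def norm_mult \<kappa>_def norm_divide)
  qed
  then have "norm (a t * E t) \<le> 2 * K * norm (E t)" for t
    unfolding norm_mult by (intro mult_right_mono) auto
  from linear_growth_nonvanishing[OF E this, of t s] neq show False by (simp add: E_def)
qed

text \<open>Let \<open>s\<close> tend to minus infinity in
  \<open>cross_products_proportional\<close>; the rotation of the limit state enters both sides as
  the same square and cancels.\<close>

lemma v_cross_ratio:
  assumes ijkl: "i \<in> {1..N}" "j \<in> {1..N}" "k \<in> {1..N}" "l \<in> {1..N}"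
  shows "(v i t - v j t) * (v k t - v l t) * ((w i - w k) * (w j - w l)) =
    (w i - w j) * (w k - w l) * ((v i t - v k t) * (v j t - v l t))"
proof -
  define p where "p = cis (b - pi)"
  let ?X = "\<lambda>t. (v i t - v j t) * (v k t - v l t)"
  let ?Y = "\<lambda>t. (v i t - v k t) * (v j t - v l t)"
  have "((\<lambda>s. ?X t * ?Y s) \<longlongrightarrow> ?X t * ((p * w i - p * w k) * (p * w j - p * w l))) at_bot"
    unfolding p_def by (intro tendsto_intros v_lim ijkl)
  moreover have "((\<lambda>s. ?X s * ?Y t) \<longlongrightarrow> (p * w i - p * w j) * (p * w k - p * w l) * ?Y t) at_bot"
    unfolding p_def by (intro tendsto_intros v_lim ijkl)
  moreover have "(\<lambda>s. ?X t * ?Y s) = (\<lambda>s. ?X s * ?Y t)"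
    by (rule ext) (rule cross_products_proportional[OF ijkl])
  ultimately have "?X t * ((p * w i - p * w k) * (p * w j - p * w l)) = (p * w i - p * w j) * (p * w k - p * w l) * ?Y t"
    by (simp only:) (rule tendsto_unique[OF trivial_limit_at_bot_linorder])
  then have "p\<^sup>2 * (?X t * ((w i - w k) * (w j - w l))) = p\<^sup>2 * ((w i - w j) * (w k - w l) * ?Y t)"
    by (simp add: algebra_simps power2_eq_square)
  moreover have "p \<noteq> 0" by (simp add: p_def)
  ultimately show ?thesis by simp
qed

text \<open>The rates add up to K times the imaginary part of
  \<open>Z t * cnj (of_nat N * Z t)\<close>, which is real.\<close>

lemma prod_v_constant: "(\<Prod>i=1..N. v i t) = (\<Prod>i=1..N. v i s)"
proof -
  have "((\<lambda>t. \<Prod>i=1..N. v i t) has_derivative (\<lambda>h. 0)) (at t)" for t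
  proof (rule has_derivative_eq_rhs)
    let ?r = "\<lambda>i. K * Im (Z t * cnj (v i t))"
    show "((\<lambda>t. \<Prod>i=1..N. v i t) has_derivative
        (\<lambda>h. \<Sum>i=1..N. (h *\<^sub>R (of_real (?r i) * \<i> * v i t)) * (\<Prod>j\<in>{1..N} - {i}. v j t))) (at t)"
      by (rule has_derivative_prod) (use v_rate in \<open>simp add: has_vector_derivative_def\<close>)
    have "(\<Sum>i=1..N. ?r i) = K * Im (Z t * cnj (\<Sum>i=1..N. v i t))"
      by (simp only: sum_distrib_left cnj_sum Im_sum)
    also have "Z t * cnj (\<Sum>i=1..N. v i t) = of_real (real N * (norm (Z t))\<^sup>2)"
      unfolding sum_v of_real_mult complex_norm_square by simp
    finally have r0: "(\<Sum>i=1..N. ?r i) = 0" by simp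
    have "(\<Sum>i=1..N. (h *\<^sub>R (of_real (?r i) * \<i> * v i t)) * (\<Prod>j\<in>{1..N} - {i}. v j t))
        = (\<Sum>i=1..N. of_real (?r i) * (of_real h * \<i> * (\<Prod>j=1..N. v j t)))" for h
      by (intro sum.cong refl, subst prod.remove[of "{1..N}"]) (auto simp: scaleR_conv_of_real mult_ac)
    also have "\<dots> h = of_real (\<Sum>i=1..N. ?r i) * (of_real h * \<i> * (\<Prod>j=1..N. v j t))" for h
      by (simp only: of_real_sum sum_distrib_right)
    finally show "(\<lambda>h. \<Sum>i=1..N. (h *\<^sub>R (of_real (?r i) * \<i> * v i t)) * (\<Prod>j\<in>{1..N} - {i}. v j t)) = (\<lambda>h. 0)"
      unfolding r0 by (simp add: fun_eq_iff)
  qed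
  then show ?thesis
    by (intro has_derivative_zero_unique[of UNIV, where f = "\<lambda>t. \<Prod>i=1..N. v i t"]) auto
qed

end

section \<open>Reconstruction of the Moebius parameter and the rotation along a trajectory\<close>

context kuramoto_unstable
begin

abbreviation "num t \<equiv> mobius_num (w 1) (w 2) (w 3) (v 1 t) (v 2 t) (v 3 t)"
abbreviation "den t \<equiv> mobius_den (w 1) (w 2) (w 3) (v 1 t) (v 2 t) (v 3 t)"

lemma three_indices: "1 \<in> {1..N}" "2 \<in> {1..N}" "3 \<in> {1..N}"
  using N by auto

lemma num_den_continuous: "continuous_on UNIV num" "continuous_on UNIV den"
  unfolding mobius_num_def mobius_den_def
  by (intro continuous_intros v_continuous three_indices)+

lemma num_den_lim:
  shows "(num \<longlongrightarrow> 0) at_bot" and "\<exists>l. l \<noteq> 0 \<and> (den \<longlongrightarrow> l) at_bot"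
proof -
  define p where "p = cis (b - pi)"
  define l where "l = mobius_den (w 1) (w 2) (w 3) (p * w 1) (p * w 2) (p * w 3)"
  define m where "m = mobius_num (w 1) (w 2) (w 3) (p * w 1) (p * w 2) (p * w 3)"
  have "(num \<longlongrightarrow> m) at_bot" unfolding m_def mobius_num_def p_def
    by (intro tendsto_intros v_lim three_indices)
  moreover have "(den \<longlongrightarrow> l) at_bot" unfolding l_def mobius_den_def p_def
    by (intro tendsto_intros v_lim three_indices)
  moreover have "l \<noteq> 0" "cnj (m / l) = 0"
    using mobius_recover[of 0 p "w 1" "w 2" "w 3"] node_distinct[OF N]
    by (simp_all add: l_def m_def p_def)
  ultimately show "(num \<longlongrightarrow> 0) at_bot" "\<exists>l. l \<noteq> 0 \<and> (den \<longlongrightarrow> l) at_bot" by auto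
qed

text \<open>The orientation of the three points cannot change along the trajectory.\<close>

lemma num_less_den: "norm (num t) < norm (den t)"
proof -
  obtain l where l: "l \<noteq> 0" "(den \<longlongrightarrow> l) at_bot" using num_den_lim(2) by blast
  have "norm (den t) - norm (num t) > 0"
  proof (rule nonvanishing_pos[where f = "\<lambda>t. norm (den t) - norm (num t)" and l = "norm l - norm (0::complex)"])
    show "continuous_on UNIV (\<lambda>t. norm (den t) - norm (num t))"
      by (intro continuous_intros num_den_continuous)
    show "((\<lambda>t. norm (den t) - norm (num t)) \<longlongrightarrow> norm l - norm (0::complex)) at_bot"
      by (intro tendsto_intros l num_den_lim)
    show "norm (den t) - norm (num t) \<noteq> 0" for t
      using norm_mobius_den_neq[of "v 1 t" "v 2 t" "v 3 t" "w 1" "w 2" "w 3"] node_distinct[OF N]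
        v_distinct three_indices by simp
  qed (use l in auto)
  then show ?thesis by simp
qed

lemma den_nonzero: "den t \<noteq> 0"
  using num_less_den[of t] by auto

definition z :: "real \<Rightarrow> complex"
  where "z t = cnj (num t / den t)"

text \<open>The quotient of \<open>v 1 t\<close> by the unimodular
  \<open>mobius (z t) (w 1)\<close>; this explicit form makes the rotation continuous in
  time.\<close>

definition p :: "real \<Rightarrow> complex"
  where "p t = v 1 t * cnj (mobius (z t) (w 1))"

lemma z_continuous: "continuous_on UNIV z"
  unfolding z_def using den_nonzero by (intro continuous_intros num_den_continuous) auto

lemma z_lim: "(z \<longlongrightarrow> 0) at_bot"
proof -
  obtain l where l: "l \<noteq> 0" "(den \<longlongrightarrow> l) at_bot" using num_den_lim(2) by blast
  have "(z \<longlongrightarrow> cnj (0 / l)) at_bot"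
    unfolding z_def by (intro tendsto_intros l num_den_lim)
  then show ?thesis by simp
qed

lemma norm_z: "norm (z t) < 1"
  and v_eq: "i \<in> {1..N} \<Longrightarrow> v i t = p t * mobius (z t) (w i)"
proof -
  have vd: "v 1 t \<noteq> v 2 t" "v 2 t \<noteq> v 3 t" "v 3 t \<noteq> v 1 t"
    using v_distinct three_indices by simp_all
  note ex = mobius_exists[OF norm_v norm_v norm_v vd norm_node norm_node norm_node
      node_distinct[OF N] num_less_den, folded z_def]
  show z: "norm (z t) < 1" using ex(1) .
  obtain p' where p': "norm p' = 1" "v 1 t = p' * mobius (z t) (w 1)"
    "v 2 t = p' * mobius (z t) (w 2)" "v 3 t = p' * mobius (z t) (w 3)"
    using ex(2) by blast
  have "mobius (z t) (w 1) * cnj (mobius (z t) (w 1)) = 1"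
    using z by (intro cnj_unimodular) simp
  then have pp: "p t = p'" unfolding p_def p'(2) by (simp add: mult.assoc)
  show "v i t = p t * mobius (z t) (w i)" if i: "i \<in> {1..N}"
  \<comment> \<open>For i = 2 the factor \<open>w 2 - w i\<close> vanishes and the cross ratio says
    nothing, but this index is among the three fitted ones.\<close>
  proof (cases "i = 2")
    case False
    have c: "(w 1 - w 3) * (w 2 - w i) \<noteq> 0"
      using node_distinct[OF N] False node_inject[OF three_indices(2) i] by auto
    let ?u = "\<lambda>i. mobius (z t) (w i)"
    have "(?u 1 - ?u 2) * (?u 3 - ?u i) * ((w 1 - w 3) * (w 2 - w i)) =
        (w 1 - w 2) * (w 3 - w i) * ((?u 1 - ?u 3) * (?u 2 - ?u i))"
      by (rule mobius_cross_ratio) (simp_all add: z)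
    then have "(v 1 t - v 2 t) * (v 3 t - p' * ?u i) * ((w 1 - w 3) * (w 2 - w i)) =
        (w 1 - w 2) * (w 3 - w i) * ((v 1 t - v 3 t) * (v 2 t - p' * ?u i))"
      unfolding p' by algebra
    from cross_ratio_unique[OF v_cross_ratio[OF three_indices i] this vd(1,2) c] show ?thesis
      by (simp add: pp)
  qed (use p' pp in simp)
qed

lemma p_continuous: "continuous_on UNIV p"
proof -
  have "continuous_on UNIV (\<lambda>t. mobius (z t) (w 1))"
    by (rule continuous_on_compose2[OF continuous_on_mobius z_continuous]) (auto simp: norm_z)
  then show ?thesis unfolding p_def by (intro continuous_intros v_continuous three_indices)
qed

text \<open>The rotation stripped of the z-dependent part of \<open>disc_phase\<close>; the value
  \<open>cis (b - pi)\<close> is thus the mean condition.\<close>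

definition phase :: "real \<Rightarrow> complex"
  where "phase t = p t * cis (- (2 / real N * (\<Sum>j=1..N. twist (z t) (w j))))"

lemma phase_continuous: "continuous_on UNIV phase"
proof -
  have "continuous_on UNIV (\<lambda>t. twist (z t) (w j))" for j
    by (rule continuous_on_compose2[OF continuous_on_twist z_continuous]) (auto simp: norm_z)
  then show ?thesis unfolding phase_def by (intro continuous_intros p_continuous)
qed

lemma phase_lim: "(phase \<longlongrightarrow> cis (b - pi)) at_bot"
proof -
  have tw: "((\<lambda>t. twist (z t) (w j)) \<longlongrightarrow> twist 0 (w j)) at_bot" for j
    by (rule continuous_on_tendsto_compose[OF continuous_on_twist z_lim]) (auto simp: norm_z)
  have "((\<lambda>t. mobius (z t) (w 1)) \<longlongrightarrow> mobius 0 (w 1)) at_bot"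
    by (rule continuous_on_tendsto_compose[OF continuous_on_mobius z_lim]) (auto simp: norm_z)
  then have "(p \<longlongrightarrow> cis (b - pi) * w 1 * cnj (mobius 0 (w 1))) at_bot"
    unfolding p_def by (intro tendsto_intros v_lim three_indices)
  then have "(phase \<longlongrightarrow> cis (b - pi) * w 1 * cnj (mobius 0 (w 1)) *
      cis (- (2 / real N * (\<Sum>j=1..N. twist 0 (w j))))) at_bot"
    unfolding phase_def by (intro tendsto_intros isCont_tendsto_compose[of _ cis] tw) (auto intro!: continuous_intros)
  then show ?thesis by (simp add: twist_def cnj_unimodular mult.assoc)
qed

text \<open>By conservation of \<open>\<Prod>\<^sub>i v\<^sub>i\<close>, the \<open>N\<close>-th power of the continuous function \<open>phase\<close> is constant.\<close>

lemma phase_constant: "phase t = cis (b - pi)"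
proof -
  have pw: "(\<Prod>i=1..N. v i s) = phase s ^ N * (\<Prod>i=1..N. w i)" for s
  proof -
    have "(\<Prod>i=1..N. v i s) = (\<Prod>i=1..N. p s * (w i * cis (- 2 * twist (z s) (w i))))"
      by (intro prod.cong refl) (simp add: v_eq mobius_eq_twist norm_z)
    also have "\<dots> = p s ^ N * (\<Prod>i=1..N. w i) * (\<Prod>i=1..N. cis (- 2 * twist (z s) (w i)))"
      by (simp add: prod.distrib)
    also have "(\<Prod>i\<in>I. cis (- 2 * twist (z s) (w i))) = cis (- 2 * (\<Sum>i\<in>I. twist (z s) (w i)))" if "finite I" for I
      using that by induction (simp_all add: cis_mult algebra_simps)
    then have "(\<Prod>i=1..N. cis (- 2 * twist (z s) (w i))) = cis (- 2 * (\<Sum>i=1..N. twist (z s) (w i)))" by blast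
    also have "\<dots> = cis (- (2 / real N * (\<Sum>j=1..N. twist (z s) (w j)))) ^ N"
      using N by (simp add: Complex.DeMoivre)
    finally show ?thesis by (simp add: phase_def power_mult_distrib mult_ac)
  qed
  have w0: "(\<Prod>i=1..N. w i) \<noteq> 0"
    by (simp, metis norm_node norm_zero zero_neq_one)
  have "phase s ^ N = phase t ^ N" for s
    using prod_v_constant[of t s] w0 unfolding pw by simp
  \<comment> \<open>Only finitely many N-th roots are available, so a continuous
    \<open>phase\<close> cannot move, and its limit tells which root it is.\<close>
  then have "range phase \<subseteq> {x. x ^ N = phase t ^ N}" by auto
  moreover have "finite {x. x ^ N = phase t ^ N}" using N by (intro finite_nth_roots) auto
  ultimately have "finite (range phase)" by (rule finite_subset)
  then have "phase constant_on UNIV"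
    by (intro continuous_finite_range_constant phase_continuous) auto
  then have "phase s = phase t" for s by (auto simp: constant_on_def)
  then have "(phase \<longlongrightarrow> phase t) at_bot" by (intro tendsto_eventually always_eventually) blast
  from tendsto_unique[OF _ this phase_lim] show ?thesis by simp
qed

lemma trajectory_eq_disc_point: "\<theta> t = disc_point N b (z t)"
proof
  fix i
  show "\<theta> t i = disc_point N b (z t) i"
  proof (cases "i \<in> {1..N}")
    case True
    have "p t = phase t * cis (2 / real N * (\<Sum>j=1..N. twist (z t) (w j)))"
      by (simp add: phase_def cis_mult mult.assoc)
    also have "\<dots> = cis (disc_phase N b (z t))"
      unfolding phase_constant disc_phase_def by (simp add: cis_mult)
    finally have "circle_cis (\<theta> t i) = circle_cis (disc_point N b (z t) i)"
      using v_eq[OF True, of t] circle_cis_disc_point[OF True norm_z] by (simp add: v_def)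
    then show ?thesis by (simp add: circle_cis_inject)
  next
    case False
    then show ?thesis using sol
      by (auto simp: kuramoto_solution_def torus_def disc_point_def PiE_def extensional_def)
  qed
qed

end

lemma unstable_manifold_eq_disc_image:
  assumes "K > 0" "N \<ge> 3"
  shows "unstable_manifold K N (incoherent_state N (proj b)) = disc_point N b ` ball 0 1"
proof
  show "disc_point N b ` ball 0 1 \<subseteq> unstable_manifold K N (incoherent_state N (proj b))"
    using disc_point_in_unstable_manifold[OF assms] by auto
  show "unstable_manifold K N (incoherent_state N (proj b)) \<subseteq> disc_point N b ` ball 0 1"
  proof
    fix \<theta>0
    assume "\<theta>0 \<in> unstable_manifold K N (incoherent_state N (proj b))"
    then obtain \<theta> where "kuramoto_solution K N UNIV \<theta>" and 0: "\<theta> 0 = \<theta>0"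
      and "(\<theta> \<longlongrightarrow> incoherent_state N (proj b)) at_bot"
      unfolding unstable_manifold_def by blast
    then interpret kuramoto_unstable K N b \<theta> by unfold_locales (use assms in auto)
    show "\<theta>0 \<in> disc_point N b ` ball 0 1"
      using trajectory_eq_disc_point[of 0] norm_z[of 0] 0 by auto
  qed
qed

section \<open>The parametrisation by phi\<close>

text \<open>With x the argument of the tangent, 2x is 2A plus the angle of the node. The arctan of
  \<open>phi_alt\<close> is then the angle of 1 + \<beta> exp (2ix), which equals
  \<open>1 + cnj z * node N i\<close> for this z.\<close>

lemma phi_i_eq_lift:
  assumes "\<beta> \<in> {0..<1}" "N > 0"
  shows "phi_i N i \<alpha> \<beta> A = lift N (2 * A - \<alpha>) (of_real \<beta> * cis (- 2 * A)) i"
proof -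
  define x where "x = pi * ((2 * real i - 1) / (2 * real N)) + A"
  define g where "g = 1 + cnj (of_real \<beta> * cis (- 2 * A)) * node N i"
  have x2: "2 * x = 2 * A + pi * (2 * real i - 1) / real N"
    using assms(2) by (simp add: x_def field_simps)
  have g: "g = 1 + of_real \<beta> * cis (2 * x)"
    unfolding g_def node_def x2 cis_mult[symmetric] by (simp add: cis_cnj mult.assoc)
  have "Re g > 0"
    unfolding g by (rule Re_one_plus_pos) (use assms in \<open>simp add: norm_mult\<close>)
  then have "Im (Ln g) = arctan (Im g / Re g)"
    using arg_conv_arctan[of g] Arg_eq_Im_Ln[of g] by (cases "g = 0") auto
  also have "Im g / Re g = \<beta> * sin (2 * x) / (1 + \<beta> * cos (2 * x))" by (simp add: g)
  finally have "twist (of_real \<beta> * cis (- 2 * A)) (node N i)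
      = arctan (\<beta> * sin (2 * x) / (1 + \<beta> * cos (2 * x)))" by (simp add: twist_def g_def)
  then show ?thesis
    unfolding phi_i_def lift_def phi_alt[OF assms(1) x_def[symmetric]] x2 by simp
qed

lemma mean_lift:
  assumes "N > 0"
  shows "1 / real N * (\<Sum>i=1..N. lift N a z i) = b + (a - disc_phase N b z)"
proof -
  have "(\<Sum>i=1..n. 2 * real i - 1) = (real n)\<^sup>2" for n :: nat
    by (induction n) (auto simp: power2_eq_square algebra_simps)
  moreover have "(\<Sum>i=1..N. pi * (2 * real i - 1) / real N) = pi / real N * (\<Sum>i=1..N. 2 * real i - 1)"
    by (simp add: sum_distrib_left)
  ultimately have "(\<Sum>i=1..N. pi * (2 * real i - 1) / real N) = real N * pi"
    using assms by (simp add: power2_eq_square)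
  then have "(\<Sum>i=1..N. lift N a z i) = real N * (pi + a) - 2 * (\<Sum>i=1..N. twist z (node N i))"
    by (simp add: lift_def sum.distrib sum_subtractf sum_distrib_left algebra_simps)
  then show ?thesis using assms by (simp add: disc_phase_def field_simps)
qed

text \<open>As the average precedes the projection, \<open>a\<close> enters it with coefficient 1
  and \<open>cis a\<close> itself is determined, not just a power of it.\<close>

lemma proj_mean_lift_iff:
  assumes "N > 0"
  shows "proj (1 / real N * (\<Sum>i=1..N. lift N a z i)) = proj b \<longleftrightarrow> cis a = cis (disc_phase N b z)"
  unfolding mean_lift[OF assms, of a z b] proj_eq_iff cis_mult[symmetric] cis_divide[symmetric]
  by (simp add: field_simps)

lemma disc_image_eq_phi:
  assumes "N > 0"
  shows "disc_point N b ` ball 0 1 =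
    {\<theta> \<in> torus N. \<exists>\<alpha> \<beta> A.
       (\<forall>i\<in>{1..N}. \<theta> i = proj (phi_i N i \<alpha> \<beta> A)) \<and>
       proj (1 / real N * (\<Sum>i=1..N. phi_i N i \<alpha> \<beta> A)) = proj b \<and>
       \<beta> \<in> {0..<1} \<and> \<alpha> \<in> {-pi..pi} \<and> A \<in> {-(pi/2)..pi/2}}"
    (is "_ = ?R")
proof
  have lift_eq: "proj (lift N a z i) = disc_point N b z i"
    if "cis a = cis (disc_phase N b z)" "i \<in> {1..N}" for a z i
    using that by (simp add: disc_point_def proj_eq_iff lift_def flip: cis_mult cis_divide)
  show "disc_point N b ` ball 0 1 \<subseteq> ?R"
  proof
    fix \<theta>
    assume "\<theta> \<in> disc_point N b ` ball 0 1"
    then obtain z where z: "norm z < 1" "\<theta> = disc_point N b z" by auto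
    \<comment> \<open>Polar coordinates of z, the half coming from the factor 2 in
      \<open>cis (- 2 * A)\<close>. Only 2A - \<alpha> modulo 2 pi matters, so \<alpha> can be
      normalised by \<open>Arg\<close>.\<close>
    define A where "A = - Arg z / 2"
    define \<alpha> where "\<alpha> = Arg (cis (2 * A - disc_phase N b z))"
    have zA: "of_real (norm z) * cis (- 2 * A) = z"
      using rcis_cmod_Arg[of z] by (simp add: A_def rcis_def)
    have "cis \<alpha> = cis (2 * A - disc_phase N b z)"
      using cis_Arg[of "cis (2 * A - disc_phase N b z)"] by (simp add: \<alpha>_def sgn_div_norm)
    then have c: "cis (2 * A - \<alpha>) = cis (disc_phase N b z)"
      by (simp flip: cis_divide)
    have phi: "phi_i N i \<alpha> (norm z) A = lift N (2 * A - \<alpha>) z i" for i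
      using phi_i_eq_lift[of "norm z" N i \<alpha> A] z(1) assms unfolding zA by simp
    have "- pi < Arg z" "Arg z \<le> pi" "- pi < \<alpha>" "\<alpha> \<le> pi"
      unfolding \<alpha>_def by (rule mpi_less_Arg Arg_le_pi)+
    then have "\<alpha> \<in> {-pi..pi}" "A \<in> {-(pi/2)..pi/2}" by (auto simp: A_def)
    moreover have "\<forall>i\<in>{1..N}. \<theta> i = proj (phi_i N i \<alpha> (norm z) A)"
      using lift_eq[OF c] by (simp add: phi z)
    moreover have "proj (1 / real N * (\<Sum>i=1..N. phi_i N i \<alpha> (norm z) A)) = proj b"
      unfolding phi using proj_mean_lift_iff[OF assms] c by blast
    moreover have "norm z \<in> {0..<1}" "\<theta> \<in> torus N"
      using z disc_point_in_torus[of N b z] by auto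
    ultimately show "\<theta> \<in> ?R" by blast
  qed
  show "?R \<subseteq> disc_point N b ` ball 0 1"
  proof
    fix \<theta>
    assume "\<theta> \<in> ?R"
    then obtain \<alpha> \<beta> A where \<theta>: "\<theta> \<in> torus N" "\<And>i. i \<in> {1..N} \<Longrightarrow> \<theta> i = proj (phi_i N i \<alpha> \<beta> A)"
      and mean: "proj (1 / real N * (\<Sum>i=1..N. phi_i N i \<alpha> \<beta> A)) = proj b"
      and \<beta>: "\<beta> \<in> {0..<1}" by blast
    define z where "z = of_real \<beta> * cis (- 2 * A)"
    note phi = phi_i_eq_lift[OF \<beta> assms, of _ \<alpha> A, folded z_def]
    have "norm z < 1" using \<beta> by (simp add: z_def norm_mult)
    have c: "cis (2 * A - \<alpha>) = cis (disc_phase N b z)"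
      using mean proj_mean_lift_iff[OF assms] unfolding phi by blast
    have "\<theta> = disc_point N b z"
    proof
      fix i
      show "\<theta> i = disc_point N b z i"
      proof (cases "i \<in> {1..N}")
        case True
        then show ?thesis using lift_eq[OF c] \<theta>(2) by (simp add: phi)
      next
        case False
        then show ?thesis using \<theta>(1) by (auto simp: torus_def disc_point_def PiE_def extensional_def)
      qed
    qed
    then show "\<theta> \<in> disc_point N b ` ball 0 1" using \<open>norm z < 1\<close> by auto
  qed
qed

section \<open>The embedding of the disc\<close>

text \<open>The inverse supplied by \<open>mobius_recover\<close>: rational in three coordinates and
  their conjugation, hence continuous on the image.\<close>

definition disc_coord :: "nat \<Rightarrow> (nat \<Rightarrow> circle) \<Rightarrow> complex"
  where "disc_coord N \<theta> = cnj
    (mobius_num (node N 1) (node N 2) (node N 3) (circle_cis (\<theta> 1)) (circle_cis (\<theta> 2)) (circle_cis (\<theta> 3)) /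
     mobius_den (node N 1) (node N 2) (node N 3) (circle_cis (\<theta> 1)) (circle_cis (\<theta> 2)) (circle_cis (\<theta> 3)))"

lemma disc_coord_disc_point:
  assumes "N \<ge> 3" "norm z < 1"
  shows "disc_coord N (disc_point N b z) = z"
    and "mobius_den (node N 1) (node N 2) (node N 3) (circle_cis (disc_point N b z 1))
      (circle_cis (disc_point N b z 2)) (circle_cis (disc_point N b z 3)) \<noteq> 0"
  using mobius_recover[OF assms(2) _ norm_node norm_node norm_node node_distinct[OF assms(1)],
      of "cis (disc_phase N b z)"] assms
  by (simp_all add: disc_coord_def circle_cis_disc_point)

lemma continuous_on_disc_coord:
  assumes "N \<ge> 3"
  shows "continuous_on (disc_point N b ` ball 0 1) (disc_coord N)"
proof -
  have c: "continuous_on S (\<lambda>x::nat \<Rightarrow> circle. circle_cis (x i))" for S i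
    by (rule continuous_on_subset[OF continuous_on_compose2[OF continuous_on_circle_cis continuous_on_product_coordinates]]) auto
  show ?thesis
    unfolding disc_coord_def
    using disc_coord_disc_point(2)[OF assms] c
    by (intro continuous_intros) (auto simp: mobius_num_def mobius_den_def intro!: continuous_intros)
qed

text \<open>Otherwise the three points \<open>w\<close> are roots of one nonzero quadratic polynomial.\<close>

lemma twist_derivative_inject:
  assumes z: "norm z < 1" and w: "norm w1 = 1" "norm w2 = 1" "norm w3 = 1" "w1 \<noteq> w2" "w2 \<noteq> w3" "w3 \<noteq> w1"
    and c: "\<And>w. w \<in> {w1, w2, w3} \<Longrightarrow> Im (cnj k * w / (1 + cnj z * w)) = c"
  shows "k = 0"
proof -
  \<comment> \<open>This is \<open>q - cnj q = 2 * \<i> * c\<close> multiplied by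
    \<open>(1 + cnj z * x) * (x + z)\<close>.\<close>
  have eq: "(cnj k - 2 * \<i> * c * cnj z) * x\<^sup>2 + (cnj k * z - k * cnj z - 2 * \<i> * c * (1 + z * cnj z)) * x
      + (- k - 2 * \<i> * c * z) = 0" if x: "x \<in> {w1, w2, w3}" for x
  proof -
    have nx: "norm x = 1" using x w by auto
    note g = mobius_denom_nonzero[OF z nx]
    define q where "q = cnj k * x / (1 + cnj z * x)"
    have q: "q * (1 + cnj z * x) = cnj k * x" using g by (simp add: q_def)
    then have "cnj q * (1 + z * cnj x) = k * cnj x"
      by (metis complex_cnj_add complex_cnj_cnj complex_cnj_mult complex_cnj_one)
    then have q': "cnj q * (x + z) = k" using cnj_unimodular[OF nx] by algebra
    have "Im q = c" using c[OF x] by (simp add: q_def)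
    then have "q - cnj q = 2 * \<i> * c" by (simp add: complex_diff_cnj)
    then show ?thesis using q q' by algebra
  qed
  note q = quadratic_three_roots[OF eq w(4-6)]
  \<comment> \<open>The outer coefficients give \<open>k = - 2 * \<i> * c * z\<close> and its
    conjugate; inserted into the middle one they leave this relation.\<close>
  have "(complex_of_real c) * (1 - z * cnj z) = 0"
  proof -
    have "\<i> * (complex_of_real c * (1 - z * cnj z)) = 0" using q by algebra
    then show ?thesis by simp
  qed
  moreover have "z * cnj z \<noteq> 1"
  proof
    assume "z * cnj z = 1"
    then have "complex_of_real ((norm z)\<^sup>2) = 1" by (simp only: complex_norm_square)
    then have "(norm z)\<^sup>2 = 1" by (simp only: of_real_eq_1_iff)
    then show False using z norm_ge_zero[of z] by (auto simp: power2_eq_1_iff)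
  qed
  ultimately have "c = 0" by simp
  then show "k = 0" using q(3) by simp
qed

definition vec_complex :: "real^2 \<Rightarrow> complex"
  where "vec_complex u = Complex (u $ 1) (u $ 2)"

lemma norm_vec_complex: "norm (vec_complex u) = norm u"
  by (simp add: vec_complex_def norm_vec_def L2_set_def sum_2 complex_norm)

lemma bounded_linear_vec_complex: "bounded_linear vec_complex"
  by (rule bounded_linear_intro[of _ 1])
     (auto simp: norm_vec_complex, auto simp: vec_complex_def complex_eq_iff)

text \<open>One global chart serves all points: \<open>disc_coord\<close> inverts it, and
  \<open>twist_derivative_inject\<close> makes it an immersion.\<close>

lemma embedded_disc_image:
  assumes "N \<ge> 3"
  shows "embedded_C1_submanifold TYPE(real^2) N (disc_point N b ` ball 0 1)"
proof -
  define f where "f u = disc_point N b (vec_complex u)" for u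
  define g where "g \<theta> = (vector [Re (disc_coord N \<theta>), Im (disc_coord N \<theta>)] :: real^2)" for \<theta>
  define T where "T j u h = Im (cnj (vec_complex h) * node N j / (1 + cnj (vec_complex u) * node N j))" for j u h
  define D where "D i u h = 2 / real N * (\<Sum>j=1..N. T j u h) - 2 * T i u h" for i u h
  let ?U = "ball (0::real^2) 1" and ?M = "disc_point N b ` ball 0 1"
  have lt: "norm (vec_complex u) < 1" if "u \<in> ?U" for u using that by (simp add: norm_vec_complex)
  have inv: "vec_complex (vector [Re z, Im z]) = z" "vector [Re (vec_complex u), Im (vec_complex u)] = u" for z u
    by (simp_all add: vec_complex_def vec_eq_iff forall_2)
  have img: "vec_complex ` ?U = ball 0 1"
  proof -
    have "z \<in> vec_complex ` ?U" if "norm z < 1" for z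
      using that inv(1)[of z] norm_vec_complex[of "vector [Re z, Im z]"]
      by (intro image_eqI[of _ _ "vector [Re z, Im z]"]) auto
    then show ?thesis using lt by auto
  qed
  have fimg: "f ` ?U = ?M" unfolding f_def img[symmetric] by auto
  have contv: "continuous_on S vec_complex" for S
    by (rule linear_continuous_on[OF bounded_linear_vec_complex])
  have gf: "g (f u) = u" if "u \<in> ?U" for u
    using that lt inv(2) by (simp add: f_def g_def disc_coord_disc_point[OF assms])
  have hom: "homeomorphism ?U ?M f g"
  proof (rule homeomorphismI)
    show "continuous_on ?U f" unfolding f_def
      by (rule continuous_on_compose2[OF continuous_on_disc_point contv]) (use img in auto)
    show "continuous_on ?M g"
    proof -
      have "continuous_on ?M (\<lambda>\<theta>. \<chi> i::2. if i = 1 then Re (disc_coord N \<theta>) else Im (disc_coord N \<theta>))"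
      proof (rule continuous_on_vec_lambda)
        fix i :: 2
        show "continuous_on ?M (\<lambda>\<theta>. if i = 1 then Re (disc_coord N \<theta>) else Im (disc_coord N \<theta>))"
          by (cases "i = 1") (auto intro!: continuous_on_Re continuous_on_Im continuous_on_disc_coord assms)
      qed
      moreover have "g = (\<lambda>\<theta>. \<chi> i. if i = 1 then Re (disc_coord N \<theta>) else Im (disc_coord N \<theta>))"
        by (auto simp: g_def vec_eq_iff forall_2 fun_eq_iff)
      ultimately show ?thesis by simp
    qed
    show "f ` ?U \<subseteq> ?M" using fimg by simp
    show "g ` ?M \<subseteq> ?U" using gf unfolding fimg[symmetric] by auto
    show "f (g y) = y" if "y \<in> ?M" for y using that gf unfolding fimg[symmetric] by auto
  qed (use gf in auto)
  have der: "has_circle_derivative (\<lambda>v. f v i) (D i u) u ?U" if u: "u \<in> ?U" and i: "i \<in> {1..N}" for u i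
  proof -
    have v: "(vec_complex has_derivative vec_complex) (at u within ?U)"
      by (rule bounded_linear_imp_has_derivative[OF bounded_linear_vec_complex])
    have "((\<lambda>v. lift N (disc_phase N b (vec_complex v)) (vec_complex v) i) has_derivative D i u) (at u within ?U)"
      unfolding lift_def D_def T_def
      by (rule has_derivative_eq_rhs[OF has_derivative_diff[OF has_derivative_add[OF has_derivative_const
           disc_phase_has_derivative[OF v lt[OF u]]] has_derivative_mult_right[OF twist_has_derivative[OF v lt[OF u] norm_node]]]])
         simp
    then show ?thesis
      unfolding has_circle_derivative_def f_def disc_point_def
      using i by (intro exI[of _ "\<lambda>v. lift N (disc_phase N b (vec_complex v)) (vec_complex v) i"]) auto
  qed
  have cont: "continuous_on ?U (\<lambda>u. D i u h)" for i h
    unfolding D_def T_def using mobius_denom_nonzero[OF lt norm_node]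
    by (intro continuous_intros contv) auto
  \<comment> \<open>If every \<open>D i u h\<close> vanishes, all \<open>T i u h\<close> equal their
    common mean, which plays the part of \<open>c\<close> in
    \<open>twist_derivative_inject\<close>.\<close>
  have inj: "h = 0" if u: "u \<in> ?U" and h: "\<And>i. i \<in> {1..N} \<Longrightarrow> D i u h = 0" for u h
  proof -
    have "T i u h = 1 / real N * (\<Sum>j=1..N. T j u h)" if "i \<in> {1..N}" for i
      using h[OF that] by (simp add: D_def)
    moreover have "1 \<in> {1..N}" "2 \<in> {1..N}" "3 \<in> {1..N}" using assms by auto
    ultimately have "T 1 u h = 1 / real N * (\<Sum>j=1..N. T j u h)"
        "T 2 u h = 1 / real N * (\<Sum>j=1..N. T j u h)" "T 3 u h = 1 / real N * (\<Sum>j=1..N. T j u h)"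
      by blast+
    then have "Im (cnj (vec_complex h) * x / (1 + cnj (vec_complex u) * x)) = 1 / real N * (\<Sum>j=1..N. T j u h)"
      if "x \<in> {node N 1, node N 2, node N 3}" for x
      using that unfolding T_def by blast
    then have "vec_complex h = 0"
      by (rule twist_derivative_inject[OF lt[OF u] norm_node norm_node norm_node node_distinct[OF assms]])
    then show "h = 0" using norm_vec_complex[of h] by simp
  qed
  show ?thesis
    unfolding embedded_C1_submanifold_def
  proof (intro conjI ballI)
    show "?M \<subseteq> torus N" using disc_point_in_torus by auto
    fix p
    assume p: "p \<in> ?M"
    have op: "open ?U" "openin (top_of_set ?M) ?M" by simp_all
    have "\<forall>u\<in>?U. \<forall>i\<in>{1..N}. has_circle_derivative (\<lambda>v. f v i) (D i u) u ?U"
      and "\<forall>i\<in>{1..N}. \<forall>h. continuous_on ?U (\<lambda>u. D i u h)"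
      and "\<forall>u\<in>?U. \<forall>h. (\<forall>i\<in>{1..N}. D i u h = 0) \<longrightarrow> h = 0"
      using der cont inj by blast+
    with op p hom show "\<exists>U V f g D. open U \<and> openin (top_of_set ?M) V \<and> p \<in> V \<and> homeomorphism U V f g \<and>
       (\<forall>u\<in>(U :: (real^2) set). \<forall>i\<in>{1..N}. has_circle_derivative (\<lambda>v. f v i) (D i u) u U) \<and>
       (\<forall>i\<in>{1..N}. \<forall>h. continuous_on U (\<lambda>u. D i u h)) \<and>
       (\<forall>u\<in>U. \<forall>h. (\<forall>i\<in>{1..N}. D i u h = 0) \<longrightarrow> h = 0)"
      by (intro exI conjI)
  qed
qed

section \<open>The reduced dynamics\<close>

text \<open>Origin of the two coefficients: by the closed form H / z = (1 + m c) / (1 + n c), where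
  \<open>m\<close> and \<open>n\<close> are powers of -\<beta> and
  \<open>c = cis (2 * A * real N)\<close>. Making the denominator real gives the real part B and the
  imaginary part -D.\<close>

lemma order_param_polar:
  assumes "N \<ge> 2" "\<beta> \<in> {0..<1}"
  shows "order_param N (of_real \<beta> * cis (- 2 * A)) =
    of_real \<beta> * cis (- 2 * A) * (of_real (B_coeff N A \<beta>) - \<i> * of_real (D_coeff N A \<beta>))"
proof -
  obtain M where M: "N = M + 2" using assms(1) by (metis add.commute le_Suc_ex)
  define z where "z = of_real \<beta> * cis (- 2 * A)"
  define c where "c = cis (2 * A * real N)"
  define m where "m = (- \<beta>) ^ M"
  define n where "n = (- \<beta>) ^ N"
  have n: "n = \<beta>\<^sup>2 * m" by (simp add: n_def m_def M power2_eq_square)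
  have cc: "c * cnj c = 1" by (rule cnj_unimodular) (simp add: c_def)
  have nz: "norm z < 1" using assms(2) by (simp add: z_def norm_mult)
  have pw: "(- cnj z) ^ k = of_real ((- \<beta>) ^ k) * cis (2 * A * real k)" for k
  proof -
    have "- cnj z = of_real (- \<beta>) * cis (2 * A)" by (simp add: z_def cis_cnj)
    then show ?thesis by (simp only: power_mult_distrib Complex.DeMoivre of_real_power mult.commute)
  qed
  have E0: "1 + of_real n * c \<noteq> 0"
  proof -
    have "norm (of_real n * c) = \<bar>n\<bar>" by (simp add: c_def norm_mult)
    also have "\<dots> = \<beta> ^ N" using assms(2) by (simp add: n_def power_abs)
    also have "\<dots> < 1" using assms by (simp add: power_less_one_iff)
    finally have "Re (1 + of_real n * c) > 0" by (rule Re_one_plus_pos)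
    then show ?thesis by (metis less_irrefl zero_complex.simps(1))
  qed
  have "z * (of_real m * c) = - ((- cnj z) ^ (N - 1))"
  proof -
    have "cis (- 2 * A) * c = cis (2 * A * real (N - 1))"
      unfolding c_def cis_mult by (rule arg_cong[of _ _ cis]) (simp add: M algebra_simps)
    then have "z * (of_real m * c) = of_real (\<beta> * m) * cis (2 * A * real (N - 1))"
      unfolding z_def by (metis (no_types, lifting) mult.assoc mult.left_commute of_real_mult)
    then show ?thesis unfolding pw by (simp add: m_def M)
  qed
  then have H: "(1 + of_real n * c) * order_param N z = z * (1 + of_real m * c)"
    using order_param_closed_form[OF _ nz, of N] assms(1) pw[of N]
    by (simp add: n_def c_def algebra_simps)
  have den: "of_real (1 + \<beta> ^ (2 * N) + 2 * (- \<beta>) ^ N * cos (2 * A * real N))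
      = (1 + of_real n * c) * (1 + of_real n * cnj c)"
  proof -
    have "n\<^sup>2 = \<beta> ^ (2 * N)" by (simp add: n_def flip: power_mult) (simp add: power_mult mult.commute[of N 2])
    moreover have "(1 + of_real n * c) * (1 + of_real n * cnj c) = 1 + of_real (n\<^sup>2) * (c * cnj c) + of_real n * (c + cnj c)"
      by (simp add: algebra_simps power2_eq_square)
    moreover have "c + cnj c = of_real (2 * cos (2 * A * real N))" by (simp add: complex_add_cnj c_def)
    ultimately show ?thesis unfolding cc by (simp add: n_def)
  qed
  have num: "of_real (1 + \<beta> ^ (2 * N - 2) + cos (2 * A * real N) * (- \<beta>) ^ (N - 2) * (1 + \<beta>\<^sup>2))
      - \<i> * of_real (sin (2 * A * real N) * (- \<beta>) ^ (N - 2) * (\<beta>\<^sup>2 - 1))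
      = (1 + of_real m * c) * (1 + of_real n * cnj c)"
  proof -
    have mn: "m * n = \<beta> ^ (2 * N - 2)"
    proof -
      have "m * n = (- \<beta>) ^ (2 * (M + 1))" unfolding m_def n_def M power_add[symmetric] by (simp add: mult_2)
      then show ?thesis by (simp add: M power_mult)
    qed
    have "(1 + of_real m * c) * (1 + of_real n * cnj c) = 1 + of_real (m * n) * (c * cnj c) + of_real m * c + of_real n * cnj c"
      by (simp add: algebra_simps)
    then show ?thesis unfolding cc mn unfolding n
      by (simp add: complex_eq_iff c_def m_def M algebra_simps)
  qed
  have "of_real (B_coeff N A \<beta>) - \<i> * of_real (D_coeff N A \<beta>)
      = (1 + of_real m * c) * (1 + of_real n * cnj c) / ((1 + of_real n * c) * (1 + of_real n * cnj c))"
    unfolding B_coeff_def D_coeff_def num[symmetric] den[symmetric]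
    by (simp add: diff_divide_distrib)
  also have "\<dots> = (1 + of_real m * c) / (1 + of_real n * c)"
  proof -
    have "1 + of_real n * cnj c \<noteq> 0"
      using E0 by (metis complex_cnj_add complex_cnj_complex_of_real complex_cnj_mult complex_cnj_one complex_cnj_zero_iff complex_cnj_cnj)
    then show ?thesis by simp
  qed
  finally have BD: "of_real (B_coeff N A \<beta>) - \<i> * of_real (D_coeff N A \<beta>) = (1 + of_real m * c) / (1 + of_real n * c)" .
  have "order_param N z = z * (1 + of_real m * c) / (1 + of_real n * c)"
    using H E0 by (simp add: eq_divide_eq mult.commute)
  then show ?thesis unfolding BD z_def by simp
qed

lemma kuramoto_solution_cong:
  assumes eq: "\<And>t. t \<in> J \<Longrightarrow> \<theta> t = \<theta>' t" and sol: "kuramoto_solution K N J \<theta>"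
  shows "kuramoto_solution K N J \<theta>'"
  unfolding kuramoto_solution_def
proof (intro ballI conjI)
  fix t i
  assume t: "t \<in> J" and i: "i \<in> {1..N}"
  let ?D = "\<lambda>h. h * (K / real N * (\<Sum>j=1..N. circle_sin (\<theta>' t j - \<theta>' t i)))"
  have "has_circle_derivative (\<lambda>s. \<theta> s i) ?D t J"
    using sol t i unfolding kuramoto_solution_def eq[OF t, symmetric] by blast
  then obtain x where x: "\<forall>\<^sub>F s in at t within J. \<theta> s i = proj (x s)" "\<theta> t i = proj (x t)"
    "(x has_derivative ?D) (at t within J)"
    unfolding has_circle_derivative_def by blast
  have "\<forall>\<^sub>F s in at t within J. \<theta>' s i = proj (x s)"
    using x(1) unfolding eventually_at_filter by eventually_elim (use eq in force)
  then show "has_circle_derivative (\<lambda>s. \<theta>' s i) ?D t J"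
    using x(2,3) eq[OF t] unfolding has_circle_derivative_def by auto
next
  fix t
  assume t: "t \<in> J"
  then show "\<theta>' t \<in> torus N" using sol unfolding kuramoto_solution_def eq[OF t, symmetric] by blast
qed

text \<open>For z = \<beta> exp (-2iA) the equations of \<beta> and A combine to z' = K/2 (1 -
  \<beta>^2)(B - iD) z. For a = 2A - \<alpha> those of A and \<alpha> leave a' = -K \<beta>^2 D = K
  Im (cnj z H). The mean is free here, so \<open>lift\<close> with its own \<open>a\<close> takes
  the place of \<open>disc_point\<close>.\<close>

lemma reduced_solution_kuramoto:
  assumes N: "N \<ge> 3" and red: "reduced_solution K N J \<beta> \<alpha> A"
  shows "kuramoto_solution K N J (\<lambda>t. phi_point N (\<alpha> t) (\<beta> t) (A t))"
proof -
  define z where "z t = of_real (\<beta> t) * cis (- 2 * A t)" for t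
  define a where "a t = 2 * A t - \<alpha> t" for t
  define B where "B t = B_coeff N (A t) (\<beta> t)" for t
  define D where "D t = D_coeff N (A t) (\<beta> t)" for t
  have \<beta>: "\<beta> t \<in> {0..<1}"
    and \<beta>': "(\<beta> has_real_derivative K / 2 * \<beta> t * (1 - (\<beta> t)\<^sup>2) * B t) (at t within J)"
    and \<alpha>': "(\<alpha> has_real_derivative K / 2 * (1 + (\<beta> t)\<^sup>2) * D t) (at t within J)"
    and A': "(A has_real_derivative K / 4 * (1 - (\<beta> t)\<^sup>2) * D t) (at t within J)" if "t \<in> J" for t
    using red that by (auto simp: reduced_solution_def B_def D_def)
  have op: "order_param N (z t) = z t * (of_real (B t) - \<i> * of_real (D t))" if "t \<in> J" for t
    using order_param_polar[of N "\<beta> t" "A t"] N \<beta>[OF that] by (simp add: z_def B_def D_def)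
  have nz: "norm (z t) = \<beta> t" if "t \<in> J" for t using \<beta>[OF that] by (simp add: z_def norm_mult)
  have z': "(z has_vector_derivative of_real (K / 2 * (1 - (norm (z t))\<^sup>2)) * order_param N (z t)) (at t within J)"
    if t: "t \<in> J" for t
  proof -
    define k where "k = K / 2 * (1 - (\<beta> t)\<^sup>2)"
    have "((\<lambda>s. cis (- 2 * A s)) has_derivative
        (\<lambda>h. (h * (- k * D t)) *\<^sub>R (\<i> * cis (- 2 * A t)))) (at t within J)"
      by (rule has_derivative_cis[OF has_derivative_eq_rhs[OF has_derivative_mult_right[OF A'[OF t, unfolded has_field_derivative_def]]]])
         (simp add: k_def fun_eq_iff)
    then have c: "((\<lambda>s. cis (- 2 * A s)) has_vector_derivative
        of_real (- k * D t) * \<i> * cis (- 2 * A t)) (at t within J)"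
      unfolding has_vector_derivative_def
      by (rule has_derivative_eq_rhs) (auto simp: scaleR_conv_of_real mult_ac)
    have b: "((\<lambda>s. complex_of_real (\<beta> s)) has_vector_derivative of_real (\<beta> t * k * B t)) (at t within J)"
      using \<beta>'[OF t] by (intro has_vector_derivative_of_real)
        (simp add: has_real_derivative_iff_has_vector_derivative k_def mult_ac)
    show ?thesis
      unfolding nz[OF t] op[OF t] k_def[symmetric] unfolding z_def
      by (rule has_vector_derivative_eq_rhs[OF has_vector_derivative_mult[OF b c]])
         (simp add: algebra_simps)
  qed
  have a': "(a has_real_derivative K * Im (cnj (z t) * order_param N (z t))) (at t within J)" if t: "t \<in> J" for t
  proof -
    have "cnj (z t) * order_param N (z t) = of_real ((\<beta> t)\<^sup>2) * (of_real (B t) - \<i> * of_real (D t))"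
      unfolding op[OF t] nz[OF t, symmetric] complex_norm_square by (simp add: mult_ac)
    then have e: "Im (cnj (z t) * order_param N (z t)) = - (\<beta> t)\<^sup>2 * D t" by simp
    show ?thesis
      unfolding a_def e
      by (rule DERIV_cong[OF DERIV_diff[OF DERIV_cmult[OF A'[OF t]] \<alpha>'[OF t]]]) (simp add: algebra_simps)
  qed
  have sol: "kuramoto_solution K N J (\<lambda>t. \<lambda>i\<in>{1..N}. proj (lift N (a t) (z t) i))"
    by (rule lift_kuramoto_solution[OF _ _ z' a']) (use N nz \<beta> in auto)
  show ?thesis
  proof (rule kuramoto_solution_cong[OF _ sol])
    show "(\<lambda>i\<in>{1..N}. proj (lift N (a t) (z t) i)) = phi_point N (\<alpha> t) (\<beta> t) (A t)" if "t \<in> J" for t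
      using phi_i_eq_lift[OF \<beta>[OF that], of N] N by (simp add: phi_point_def a_def z_def)
  qed
qed

theorem theorem3p3:
  fixes K :: real and N :: nat and q :: circle
  assumes "K > 0" and "N \<ge> 3"
  shows "embedded_C1_submanifold TYPE(real^2) N (unstable_manifold K N (incoherent_state N q)) \<and>
    unstable_manifold K N (incoherent_state N q) =
      {\<theta> \<in> torus N. \<exists>\<alpha> \<beta> A.
         (\<forall>i\<in>{1..N}. \<theta> i = proj (phi_i N i \<alpha> \<beta> A)) \<and>
         proj (1 / real N * (\<Sum>i=1..N. phi_i N i \<alpha> \<beta> A)) = q \<and>
         \<beta> \<in> {0..<1} \<and> \<alpha> \<in> {-pi..pi} \<and> A \<in> {-(pi/2)..pi/2}} \<and>
    (\<forall>J \<beta> \<alpha> A. is_interval J \<longrightarrow> reduced_solution K N J \<beta> \<alpha> A \<longrightarrow>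
       kuramoto_solution K N J (\<lambda>t. phi_point N (\<alpha> t) (\<beta> t) (A t)))"
proof -
  have "N > 0" using assms(2) by simp
  \<comment> \<open>The real parameter \<open>b\<close> is specialised to a representative of
    \<open>q\<close>.\<close>
  have W: "unstable_manifold K N (incoherent_state N q) = disc_point N (rep_circle q) ` ball 0 1"
    using unstable_manifold_eq_disc_image[OF assms, of "rep_circle q"] by simp
  show ?thesis
    using embedded_disc_image[OF assms(2), of "rep_circle q"]
      disc_image_eq_phi[OF \<open>N > 0\<close>, of "rep_circle q"] reduced_solution_kuramoto[OF assms(2)]
    unfolding W proj_rep by blast
qed

end
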